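(* Let $\mathfrak{g}$ be the 7-dimensional real nilpotent Lie algebra whose dual $\mathfrak{g}^*$ has a basis $\{e^1,\dots,e^7\}$ with $de^1=de^2=0$, $de^3=e^{12}$, $de^4=e^{13}$, $de^5=e^{14}$, $de^6=e^{15}+e^{23}$, $de^7=e^{16}+e^{23}+e^{24}$. Then $\mathfrak{g}$ has a closed $\mathrm{G}_2^*$-structure, but $\mathfrak{g}$ does not admit any closed $\mathrm{G}_2^*$-structure $\rho$ such that the induced pseudo-metric $g_\rho$ is Einstein and non Ricci-flat. In particular, let $\{f^1,\dots,f^7\}$ be the basis of $\mathfrak{g}^*$ defined by $e^1=f^1$, $e^2=f^2$, $e^3=-\frac{26}{51}f^2+f^3$, $e^4=-\frac{2300}{2601}f^2-\frac{26}{51}f^3+f^4$, $e^5=-\frac{2300}{2601}f^3+\frac{46}{51}f^4+f^5$, $e^6=-\frac{2300}{2601}f^4+f^6$, $e^7=-\frac{50}{51}f^6+f^7$, and let $g$ be the non Ricci-flat Einstein pseudo-metric on $\mathfrak{g}$ which in the basis $\{f_1,\dots,f_7\}$ of $\mathfrak{g}$ dual to $\{f^1,\dots,f^7\}$ is the diagonal matrix $$\mathrm{diag}\Bigl(\tfrac{71639296000000000}{168377826559400929},\,-\tfrac{1946720000000}{2015993900449},\,-\tfrac{2116000000}{6975757441},\,\tfrac{21160000}{24137569},\,-\tfrac{115000}{250563},\,-\tfrac{600}{289},\,1\Bigr).$$ Then there is no closed $\mathrm{G}_2^*$-structure $\rho$ on $\mathfrak{g}$ with $g_\rho=g$.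
   Context: Here $d$ is the Chevalley–Eilenberg differential on $\Lambda^*\mathfrak{g}^*$, given on $\mathfrak{g}^*$ by $d\alpha(x,y)=-\alpha([x,y])$, and $e^{ij}$ stands for $e^i\wedge e^j$. Pseudo-metrics: a pseudo-metric on a Lie algebra is a nondegenerate symmetric bilinear form (of any signature), identified with the corresponding left-invariant pseudo-Riemannian metric on the simply connected Lie group; its Ricci curvature is that of this metric. It is Einstein if $\mathrm{Ric}(g)=\lambda g$ for some real constant $\lambda$, Ricci-flat if $\lambda=0$, non Ricci-flat if $\lambda\ne0$. $\mathrm{G}_2^*$-structures: for a 3-form $\varphi\in\Lambda^3(V^* )$ on a real 7-dimensional vector space $V$, define the symmetric form $b_\varphi:V\times V\to\Lambda^7(V^* )$ by $6\,b_\varphi(v,w)=\iota_v\varphi\wedge\iota_w\varphi\wedge\varphi$. If $b_\varphi$ is nondegenerate, put $\mathrm{vol}_\varphi=\sqrt[9]{\det(b_\varphi)}\in\Lambda^7(V^* )$ and define the nondegenerate symmetric bilinear form $g_\varphi$ by $g_\varphi(v,w)\,\mathrm{vol}_\varphi=b_\varphi(v,w)$. The 3-form $\varphi$ is a $\mathrm{G}_2^*$-structure on $V$ if $b_\varphi$ is nondegenerate and $g_\varphi$ is indefinite (it then has signature $(3,4)$); equivalently, if there is a basis $\{v^1,\dots,v^7\}$ of $V^*$ in which $\varphi=-v^{127}-v^{347}+v^{567}+v^{135}-v^{146}-v^{236}-v^{245}$, where $v^{ijk}=v^i\wedge v^j\wedge v^k$, in which case $g_\varphi=-(v^1)^2-(v^2)^2-(v^3)^2-(v^4)^2+(v^5)^2+(v^6)^2+(v^7)^2$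 and $\mathrm{vol}_\varphi=v^1\wedge\dots\wedge v^7$. A $\mathrm{G}_2^*$-structure on a 7-dimensional Lie algebra is such a 3-form $\varphi$ on it, $g_\varphi$ is the pseudo-metric it induces, and it is closed if $d\varphi=0$. *)

theory Defs
  imports "HOL-Analysis.Linear_Algebra" "Jordan_Normal_Form.Determinant"
begin

section \<open>Exterior forms\<close>

text \<open>A \<open>k\<close>-form takes a sequence of vectors \<open>v 0, v 1, \<dots>\<close> and depends only on
  \<open>v 0, \<dots>, v (k - 1)\<close>.\<close>

type_synonym 'v form = "(nat \<Rightarrow> 'v) \<Rightarrow> real"

definition is_form :: "nat \<Rightarrow> 'v::real_vector form \<Rightarrow> bool" where
  "is_form k \<omega> \<longleftrightarrow>
     (\<forall>u v. (\<forall>i<k. u i = v i) \<longrightarrow> \<omega> u = \<omega> v) \<and>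
     (\<forall>v. \<forall>i<k. linear (\<lambda>x. \<omega> (v(i := x)))) \<and>
     (\<forall>v. \<forall>i<k. \<forall>j<k. i \<noteq> j \<longrightarrow> v i = v j \<longrightarrow> \<omega> v = 0)"

definition one_form :: "('v \<Rightarrow> real) \<Rightarrow> 'v form" where
  "one_form \<alpha> = (\<lambda>v. \<alpha> (v 0))"

text \<open>The factor is chosen such that
  \<open>(\<alpha> \<and> \<beta>)(x, y) = \<alpha>(x) \<beta>(y) - \<alpha>(y) \<beta>(x)\<close> for 1-forms.\<close>

definition wedge :: "nat \<Rightarrow> nat \<Rightarrow> 'v form \<Rightarrow> 'v form \<Rightarrow> 'v form" where
  "wedge k l \<alpha> \<beta> = (\<lambda>v. (\<Sum>\<sigma> | \<sigma> permutes {..<k + l}.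
      of_int (sign \<sigma>) * \<alpha> (\<lambda>i. v (\<sigma> i)) * \<beta> (\<lambda>i. v (\<sigma> (k + i)))) / (fact k * fact l))"

definition contract :: "'v \<Rightarrow> 'v form \<Rightarrow> 'v form" where
  "contract x \<omega> = (\<lambda>v. \<omega> (case_nat x v))"

definition is_dual_basis :: "nat \<Rightarrow> (nat \<Rightarrow> 'v::real_vector \<Rightarrow> real) \<Rightarrow> bool" where
  "is_dual_basis n e \<longleftrightarrow>
     (\<forall>i\<in>{1..n}. linear (e i)) \<and>
     (\<forall>c. (\<forall>x. (\<Sum>i=1..n. c i * e i x) = 0) \<longrightarrow> (\<forall>i\<in>{1..n}. c i = 0)) \<and>
     (\<forall>\<alpha>::'v \<Rightarrow> real. linear \<alpha> \<longrightarrow> (\<exists>c. \<forall>x. \<alpha> x = (\<Sum>i=1..n. c i * e i x)))"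

text \<open>The 2-form \<open>e\<^sup>i\<^sup>j\<close>.\<close>

definition e2 :: "(nat \<Rightarrow> 'v \<Rightarrow> real) \<Rightarrow> nat \<Rightarrow> nat \<Rightarrow> 'v form" where
  "e2 e i j = wedge 1 1 (one_form (e i)) (one_form (e j))"

section \<open>Lie algebras\<close>

definition lie_algebra :: "('v::real_vector \<Rightarrow> 'v \<Rightarrow> 'v) \<Rightarrow> bool" where
  "lie_algebra br \<longleftrightarrow> bilinear br \<and> (\<forall>x. br x x = 0) \<and>
     (\<forall>x y z. br x (br y z) + br y (br z x) + br z (br x y) = 0)"

primrec lower_central :: "('v::real_vector \<Rightarrow> 'v \<Rightarrow> 'v) \<Rightarrow> nat \<Rightarrow> 'v set" where
  "lower_central br 0 = UNIV"
| "lower_central br (Suc n) = span {br x y | x y. y \<in> lower_central br n}"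

definition lie_nilpotent :: "('v::real_vector \<Rightarrow> 'v \<Rightarrow> 'v) \<Rightarrow> bool" where
  "lie_nilpotent br \<longleftrightarrow> (\<exists>n. lower_central br n = {0})"

text \<open>The Chevalley--Eilenberg differential of a \<open>k\<close>-form:
  \<open>d\<omega>(v\<^sub>0, \<dots>, v\<^sub>k)\<close> is the sum over \<open>i < j\<close> of
  \<open>(-1)\<^sup>i\<^sup>+\<^sup>j \<omega>([v\<^sub>i, v\<^sub>j], v\<^sub>0, \<dots>, v\<^sub>k)\<close> with \<open>v\<^sub>i\<close> and \<open>v\<^sub>j\<close> omitted from the
  remaining arguments. It is the antiderivation extending
  \<open>d\<alpha>(x, y) = -\<alpha>([x, y])\<close>.\<close>

definition ce_d :: "('v \<Rightarrow> 'v \<Rightarrow> 'v) \<Rightarrow> nat \<Rightarrow> 'v form \<Rightarrow> 'v form" where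
  "ce_d br k \<omega> = (\<lambda>v. \<Sum>j\<le>k. \<Sum>i<j. (-1) ^ (i + j) *
      \<omega> (case_nat (br (v i) (v j)) (\<lambda>n. v (insert_index j (insert_index i n)))))"

lemma ce_d_one_form: "ce_d br 1 (one_form \<alpha>) v = - \<alpha> (br (v 0) (v 1))"
  by (simp add: ce_d_def one_form_def)

lemma e2_eq: "e2 e i j v = e i (v 0) * e j (v 1) - e i (v 1) * e j (v 0)"
proof -
  have S: "{..<1 + 1::nat} = insert 0 {1}" by auto
  have "{\<sigma>. \<sigma> permutes {..<1 + 1::nat}} = {id, Transposition.transpose 0 1}"
    unfolding S permutes_insert
    by (auto simp: permutes_sing image_iff) (metis transpose_same)
  moreover have "id \<noteq> Transposition.transpose 0 (1::nat)"
    by (metis id_apply transpose_apply_first zero_neq_one)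
  ultimately show ?thesis
    by (simp add: e2_def wedge_def one_form_def sign_swap_id sign_id)
qed

section \<open>Left-invariant pseudo-Riemannian geometry\<close>

definition pseudo_metric :: "('v::real_vector \<Rightarrow> 'v \<Rightarrow> real) \<Rightarrow> bool" where
  "pseudo_metric g \<longleftrightarrow> bilinear g \<and> (\<forall>x y. g x y = g y x) \<and>
     (\<forall>x. (\<forall>y. g x y = 0) \<longrightarrow> x = 0)"

text \<open>The Levi-Civita connection on left-invariant vector fields: \<open>D x y\<close> is \<open>\<nabla>\<^sub>x y\<close>. For
  left-invariant \<open>y\<close>, \<open>z\<close> the function \<open>g y z\<close> is constant, so that metric compatibility reads
  \<open>0 = g (D x y) z + g y (D x z)\<close>.\<close>

definition is_levi_civita ::
  "('v::real_vector \<Rightarrow> 'v \<Rightarrow> 'v) \<Rightarrow> ('v \<Rightarrow> 'v \<Rightarrow> real) \<Rightarrow> ('v \<Rightarrow> 'v \<Rightarrow> 'v) \<Rightarrow> bool" where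
  "is_levi_civita br g D \<longleftrightarrow> bilinear D \<and> (\<forall>x y. D x y - D y x = br x y) \<and>
     (\<forall>x y z. g (D x y) z + g y (D x z) = 0)"

definition levi_civita ::
  "('v::real_vector \<Rightarrow> 'v \<Rightarrow> 'v) \<Rightarrow> ('v \<Rightarrow> 'v \<Rightarrow> real) \<Rightarrow> 'v \<Rightarrow> 'v \<Rightarrow> 'v" where
  "levi_civita br g = (THE D. is_levi_civita br g D)"

definition curvature ::
  "('v::real_vector \<Rightarrow> 'v \<Rightarrow> 'v) \<Rightarrow> ('v \<Rightarrow> 'v \<Rightarrow> real) \<Rightarrow> 'v \<Rightarrow> 'v \<Rightarrow> 'v \<Rightarrow> 'v" where
  "curvature br g x y z = (let D = levi_civita br g in
     D x (D y z) - D y (D x z) - D (br x y) z)"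

text \<open>The trace of an endomorphism, computed in an arbitrary basis; \<open>extend_basis {}\<close> is a
  (chosen) basis of the whole space.\<close>

definition endo_trace :: "('v::real_vector \<Rightarrow> 'v) \<Rightarrow> real" where
  "endo_trace f = (let B = extend_basis {} in \<Sum>b\<in>B. representation B (f b) b)"

definition ricci ::
  "('v::real_vector \<Rightarrow> 'v \<Rightarrow> 'v) \<Rightarrow> ('v \<Rightarrow> 'v \<Rightarrow> real) \<Rightarrow> 'v \<Rightarrow> 'v \<Rightarrow> real" where
  "ricci br g x y = endo_trace (\<lambda>z. curvature br g z x y)"

definition einstein_const ::
  "('v::real_vector \<Rightarrow> 'v \<Rightarrow> 'v) \<Rightarrow> ('v \<Rightarrow> 'v \<Rightarrow> real) \<Rightarrow> real \<Rightarrow> bool" where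
  "einstein_const br g c \<longleftrightarrow> (\<forall>x y. ricci br g x y = c * g x y)"

definition einstein :: "('v::real_vector \<Rightarrow> 'v \<Rightarrow> 'v) \<Rightarrow> ('v \<Rightarrow> 'v \<Rightarrow> real) \<Rightarrow> bool" where
  "einstein br g \<longleftrightarrow> (\<exists>c. einstein_const br g c)"

definition ricci_flat :: "('v::real_vector \<Rightarrow> 'v \<Rightarrow> 'v) \<Rightarrow> ('v \<Rightarrow> 'v \<Rightarrow> real) \<Rightarrow> bool" where
  "ricci_flat br g \<longleftrightarrow> einstein_const br g 0"

section \<open>\<open>G\<^sub>2\<^sup>*\<close>-structures on a 7-dimensional space\<close>

definition b_form :: "'v form \<Rightarrow> 'v \<Rightarrow> 'v \<Rightarrow> 'v form" where
  "b_form \<phi> x y = (\<lambda>v. wedge 4 3 (wedge 2 2 (contract x \<phi>) (contract y \<phi>)) \<phi> v / 6)"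

text \<open>\<open>det b\<^sub>\<phi>\<close> lives in the ninth tensor power of the line of 7-forms. On a frame \<open>v\<close> it takes the
  value \<open>det (b\<^sub>\<phi>(v\<^sub>i, v\<^sub>j)(v))\<close>: under \<open>v \<mapsto> Av\<close> the Gram matrix contributes \<open>(det A)\<^sup>2\<close> and its
  seven 7-form entries contribute \<open>(det A)\<^sup>7\<close>.\<close>

definition vol_form :: "'v form \<Rightarrow> 'v form" where
  "vol_form \<phi> = (\<lambda>v. root 9 (det (mat 7 7 (\<lambda>(i, j). b_form \<phi> (v i) (v j) v))))"

definition g_form :: "'v form \<Rightarrow> 'v \<Rightarrow> 'v \<Rightarrow> real" where
  "g_form \<phi> x y = (THE c. \<forall>v. c * vol_form \<phi> v = b_form \<phi> x y v)"

definition g2star :: "'v::real_vector form \<Rightarrow> bool" where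
  "g2star \<phi> \<longleftrightarrow> is_form 3 \<phi> \<and>
     (\<forall>x. (\<forall>y v. b_form \<phi> x y v = 0) \<longrightarrow> x = 0) \<and>
     (\<exists>x. g_form \<phi> x x > 0) \<and> (\<exists>x. g_form \<phi> x x < 0)"

definition closed_g2star :: "('v::real_vector \<Rightarrow> 'v \<Rightarrow> 'v) \<Rightarrow> 'v form \<Rightarrow> bool" where
  "closed_g2star br \<phi> \<longleftrightarrow> g2star \<phi> \<and> (\<forall>v. ce_d br 3 \<phi> v = 0)"

end

theory Submission
  imports Defs
begin

text \<open>
  Let \<open>\<rho>\<close> be a closed \<open>G\<^sub>2\<^sup>*\<close>-structure on the Lie algebra, with dual basis \<open>E\<^sub>1, \<dots>, E\<^sub>7\<close> of the
  \<open>e\<^sup>i\<close>, and suppose that \<open>g\<^sub>\<rho>\<close> is Einstein with constant \<open>\<lambda>\<close>. The obstruction sits in the direction of the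
  central vector \<open>E\<^sub>7\<close>.

  Solving \<open>d\<rho> = 0\<close> leaves 18 free coefficients, and a computation of \<open>b\<^sub>\<rho>\<close> (\<open>b_poly_closed\<close>) shows that
  \<open>E\<^sub>7\<close> is orthogonal to \<open>E\<^sub>5, E\<^sub>6, E\<^sub>7\<close>. Hence the 1-form \<open>g(E\<^sub>7, _)\<close> lies in the span of
  \<open>e\<^sup>1, \<dots>, e\<^sup>4\<close>, and its differential is decomposable: it is \<open>e\<^sup>1 \<and> \<eta>\<close> with \<open>\<eta>\<close> in the span of \<open>e\<^sup>2\<close> and
  \<open>e\<^sup>3\<close>. For a central vector \<open>c\<close> of a unimodular Lie algebra with \<open>d g(c, _) = \<alpha> \<and> \<beta>\<close>, the vectors
  \<open>p\<close>, \<open>r\<close> dual to \<open>\<alpha>\<close>, \<open>\<beta>\<close> determine the Ricci curvature by \<open>Ric(c, y) = - g([p, r], y) / 2\<close>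
  (\<open>ricci_central\<close>), and in particular \<open>Ric(c, c) = (g(p, p) g(r, r) - g(p, r)\<^sup>2) / 2\<close>. If \<open>\<eta> = 0\<close>, this
  gives \<open>\<lambda> g(E\<^sub>7, _) = 0\<close> and so \<open>\<lambda> = 0\<close>. If \<open>\<eta> \<noteq> 0\<close>, then the vector \<open>p\<close> dual to \<open>e\<^sup>1\<close> is a multiple of the
  cross product of \<open>E\<^sub>6\<close> and \<open>E\<^sub>7\<close>, and an explicit formula for it (\<open>b_poly_kernel\<close>) shows \<open>e\<^sup>1(p) = e\<^sup>2(p) = 0\<close>
  and \<open>\<eta>(p) \<noteq> 0\<close>. Then \<open>Ric(E\<^sub>7, E\<^sub>7) = - \<eta>(p)\<^sup>2 / 2\<close> is not zero although \<open>g(E\<^sub>7, E\<^sub>7) = 0\<close>, so \<open>g\<^sub>\<rho>\<close> is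
  not Einstein after all (\<open>closed_g2star_einstein_const_0\<close>).

  To make \<open>g\<^sub>\<rho>\<close> computable, contraction is shown to be an antiderivation (\<open>contract_wedge\<close>), which
  evaluates \<open>b\<^sub>\<rho>\<close> on a frame as a cubic polynomial in the coefficients of \<open>\<rho>\<close>, and \<open>g\<^sub>\<rho>\<close> is identified with
  this polynomial up to a nonzero constant (\<open>g_form_eq\<close>).

  A closed \<open>G\<^sub>2\<^sup>*\<close>-structure is exhibited in \<open>ex_closed_g2star\<close>. The diagonal metric of the theorem is
  Einstein with a nonzero constant by a computation of its Levi-Civita connection
  (\<open>diagonal_einstein_metric\<close>); the general obstruction therefore excludes that a closed
  \<open>G\<^sub>2\<^sup>*\<close>-structure induces it.
\<close>

section \<open>Alternating forms and wedge products\<close>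

lemma form_cong:
  assumes "is_form k \<omega>" "\<And>i. i < k \<Longrightarrow> u i = v i"
  shows "\<omega> u = \<omega> v"
  using assms unfolding is_form_def by blast

lemma form_linear: "is_form k \<omega> \<Longrightarrow> i < k \<Longrightarrow> linear (\<lambda>x. \<omega> (v(i := x)))"
  unfolding is_form_def by blast

lemma form_eq_args: "is_form k \<omega> \<Longrightarrow> i < k \<Longrightarrow> j < k \<Longrightarrow> i \<noteq> j \<Longrightarrow> v i = v j \<Longrightarrow> \<omega> v = 0"
  unfolding is_form_def by blast

lemma form_add:
  assumes "is_form k \<omega>" "i < k"
  shows "\<omega> (v(i := x + y)) = \<omega> (v(i := x)) + \<omega> (v(i := y))"
  using linear_add[OF form_linear[OF assms]] .

lemma form_swap:
  assumes "is_form k \<omega>" "i < k" "j < k" "i \<noteq> j"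
  shows "\<omega> (v(i := v j, j := v i)) = - \<omega> v"
proof -
  let ?s = "v i + v j"
  have "0 = \<omega> (v(i := ?s, j := ?s))"
    by (rule form_eq_args[OF assms, symmetric]) (use assms in auto)
  also have "\<dots> = \<omega> (v(i := ?s, j := v i)) + \<omega> (v(i := ?s, j := v j))"
    using form_add[OF assms(1,3)] by blast
  also have "\<dots> = \<omega> (v(j := v i, i := ?s)) + \<omega> (v(i := ?s))"
    using assms(4) by (simp add: fun_upd_twist)
  also have "\<dots> = \<omega> (v(j := v i, i := v i)) + \<omega> (v(j := v i, i := v j)) + (\<omega> (v(i := v i)) + \<omega> (v(i := v j)))"
    by (simp only: form_add[OF assms(1,2)])
  also have "\<omega> (v(j := v i, i := v i)) = 0"
    by (rule form_eq_args[OF assms]) (use assms in auto)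
  also have "\<omega> (v(i := v j)) = 0"
    by (rule form_eq_args[OF assms]) (use assms in auto)
  finally have "\<omega> (v(j := v i, i := v j)) = - \<omega> v"
    unfolding fun_upd_triv by linarith
  then show ?thesis using fun_upd_twist[OF assms(4), of v "v j" "v i"] by simp
qed

lemma form_transpose:
  assumes "is_form k \<omega>" "i < k" "j < k" "i \<noteq> j"
  shows "\<omega> (\<lambda>n. v (Transposition.transpose i j n)) = - \<omega> v"
proof -
  have "(\<lambda>n. v (Transposition.transpose i j n)) = v(i := v j, j := v i)"
    using assms(4) by (auto simp: fun_eq_iff Transposition.transpose_def)
  then show ?thesis using form_swap[OF assms] by simp
qed

text \<open>Moving the first argument of a form past \<open>m\<close> others costs the sign \<open>(-1)\<^sup>m\<close>. The intermediate
argument lists are written out, so that each step is a single swap and no sign of a cycle is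
needed.\<close>

lemma form_move:
  assumes "is_form k \<omega>" "m < k"
  shows "\<omega> (\<lambda>i. if i < m then z (Suc i) else if i = m then y else z i) = (-1) ^ m * \<omega> (z(0 := y))"
  using assms(2)
proof (induction m)
  case 0
  have "(\<lambda>i. if i = 0 then y else z i) = z(0 := y)" by auto
  then show ?case by simp
next
  case (Suc m)
  let ?w = "\<lambda>m i. if i < m then z (Suc i) else if i = m then y else z i"
  have "?w (Suc m) = (?w m)(m := ?w m (Suc m), Suc m := ?w m m)"
    by (auto simp: fun_eq_iff)
  then have "\<omega> (?w (Suc m)) = - \<omega> (?w m)"
    using form_swap[OF assms(1), of m "Suc m" "?w m"] Suc.prems by simp
  then show ?case using Suc by simp
qed

lemma is_form_contract:
  assumes "is_form (Suc k) \<omega>"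
  shows "is_form k (contract x \<omega>)"
proof -
  have upd: "case_nat x (v(i := y)) = (case_nat x v)(Suc i := y)" for v :: "nat \<Rightarrow> 'a" and i y
    by (auto simp: fun_eq_iff split: nat.splits)
  show ?thesis
    unfolding is_form_def contract_def
  proof (intro conjI allI impI)
    fix u v :: "nat \<Rightarrow> 'a" assume "\<forall>i<k. u i = v i"
    then show "\<omega> (case_nat x u) = \<omega> (case_nat x v)"
      by (intro form_cong[OF assms]) (auto split: nat.splits)
  next
    fix v :: "nat \<Rightarrow> 'a" and i assume "i < k"
    then show "linear (\<lambda>xa. \<omega> (case_nat x (v(i := xa))))"
      unfolding upd by (intro form_linear[OF assms]) auto
  next
    fix v :: "nat \<Rightarrow> 'a" and i j assume "i < k" "j < k" "i \<noteq> j" "v i = v j"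
    then show "\<omega> (case_nat x v) = 0"
      by (intro form_eq_args[OF assms, of "Suc i" "Suc j"]) auto
  qed
qed

lemma is_form_wedge:
  assumes A: "is_form k \<alpha>" and B: "is_form l \<beta>"
  shows "is_form (k + l) (wedge k l \<alpha> \<beta>)"
  unfolding is_form_def
proof (intro conjI allI impI)
  fix u v :: "nat \<Rightarrow> 'a" assume uv: "\<forall>i<k + l. u i = v i"
  have "\<alpha> (\<lambda>i. u (\<sigma> i)) = \<alpha> (\<lambda>i. v (\<sigma> i))" "\<beta> (\<lambda>i. u (\<sigma> (k + i))) = \<beta> (\<lambda>i. v (\<sigma> (k + i)))"
    if "\<sigma> permutes {..<k+l}" for \<sigma>
  proof -
    have "\<sigma> i < k + l" if "i < k + l" for i
      using permutes_in_image[OF \<open>\<sigma> permutes _\<close>, of i] that by simp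
    then show "\<alpha> (\<lambda>i. u (\<sigma> i)) = \<alpha> (\<lambda>i. v (\<sigma> i))" "\<beta> (\<lambda>i. u (\<sigma> (k + i))) = \<beta> (\<lambda>i. v (\<sigma> (k + i)))"
      using uv by (auto intro!: form_cong[OF A] form_cong[OF B])
  qed
  then show "wedge k l \<alpha> \<beta> u = wedge k l \<alpha> \<beta> v" by (simp add: wedge_def)
next
  fix v :: "nat \<Rightarrow> 'a" and i assume i: "i < k + l"
  have "linear (\<lambda>x. of_int (sign \<sigma>) * \<alpha> (\<lambda>n. (v(i := x)) (\<sigma> n)) * \<beta> (\<lambda>n. (v(i := x)) (\<sigma> (k + n))))"
    if p: "\<sigma> permutes {..<k+l}" for \<sigma>
  proof -
    define p where "p = inv_into UNIV \<sigma> i"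
    have \<sigma>p: "\<sigma> n = i \<longleftrightarrow> n = p" for n
      unfolding p_def using permutes_inverses[OF \<open>\<sigma> permutes _\<close>] by metis
    have plt: "p < k + l"
      unfolding p_def using permutes_in_image[OF permutes_inv[OF \<open>\<sigma> permutes _\<close>], of i] i by simp
    show ?thesis
    proof (cases "p < k")
      case True
      have "(\<lambda>n. (v(i := x)) (\<sigma> n)) = (\<lambda>n. v (\<sigma> n))(p := x)" for x by (auto simp: fun_eq_iff \<sigma>p)
      moreover have "(\<lambda>n. (v(i := x)) (\<sigma> (k + n))) = (\<lambda>n. v (\<sigma> (k + n)))" for x
        using True by (auto simp: fun_eq_iff \<sigma>p)
      ultimately show ?thesis
        using form_linear[OF A True, of "\<lambda>n. v (\<sigma> n)"]
        by (simp add: linear_iff algebra_simps)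
    next
      case False
      have 1: "\<alpha> (\<lambda>n. (v(i := x)) (\<sigma> n)) = \<alpha> (\<lambda>n. v (\<sigma> n))" for x
        using False by (intro form_cong[OF A]) (auto simp: \<sigma>p)
      have 2: "(\<lambda>n. (v(i := x)) (\<sigma> (k + n))) = (\<lambda>n. v (\<sigma> (k + n)))(p - k := x)" for x
        using False by (auto simp: fun_eq_iff \<sigma>p)
      show ?thesis
        using form_linear[OF B, of "p - k" "\<lambda>n. v (\<sigma> (k + n))"] False plt unfolding 1 2
        by (simp add: linear_iff algebra_simps)
    qed
  qed
  then have "linear (\<lambda>x. \<Sum>\<sigma> | \<sigma> permutes {..<k + l}. of_int (sign \<sigma>) * \<alpha> (\<lambda>n. (v(i := x)) (\<sigma> n)) * \<beta> (\<lambda>n. (v(i := x)) (\<sigma> (k + n))))"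
    by (intro linear_compose_sum) auto
  then show "linear (\<lambda>x. wedge k l \<alpha> \<beta> (v(i := x)))"
    unfolding wedge_def by (simp add: linear_iff add_divide_distrib)
next
  fix v :: "nat \<Rightarrow> 'a" and i j assume ij: "i < k + l" "j < k + l" "i \<noteq> j" "v i = v j"
  \<comment> \<open>Composing with the transposition of the two equal arguments negates every summand, so the
    alternating sum equals its own negative.\<close>
  let ?t = "Transposition.transpose i j"
  let ?f = "\<lambda>\<sigma>. of_int (sign \<sigma>) * \<alpha> (\<lambda>n. v (\<sigma> n)) * \<beta> (\<lambda>n. v (\<sigma> (k + n)))"
  let ?P = "{\<sigma>. \<sigma> permutes {..<k+l}}"
  have t: "?t permutes {..<k+l}" using ij by (intro permutes_swap_id) auto
  have vt: "v (?t n) = v n" for n using ij(4) by (auto simp: Transposition.transpose_def)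
  have "?f (?t \<circ> \<sigma>) = - ?f \<sigma>" if "\<sigma> permutes {..<k+l}" for \<sigma>
  proof -
    have "sign (?t \<circ> \<sigma>) = - sign \<sigma>"
      using ij(3) permutation_permutes[of \<sigma>] that permutation_permutes[of ?t] t
      by (subst sign_compose) (auto simp: sign_swap_id)
    then show ?thesis by (simp add: vt)
  qed
  then have "sum ?f ?P = - sum ?f ?P"
    by (subst setum_permutations_compose_left[OF t]) (simp add: sum_negf[symmetric] del: sum_negf)
  then have "sum ?f ?P = 0" by simp
  then show "wedge k l \<alpha> \<beta> v = 0" by (simp add: wedge_def)
qed

text \<open>Permutations of \<open>{1, \<dots>, N}\<close>, the stabiliser of 0, are shifted to permutations of
\<open>{0, \<dots>, N - 1}\<close>, the range over which a wedge product of total degree \<open>N\<close> sums.\<close>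

lemma sum_permutes_Suc:
  fixes H :: "(nat \<Rightarrow> nat) \<Rightarrow> real"
  shows "(\<Sum>q | q permutes {Suc 0..<Suc N}. of_int (sign q) * H q) =
    (\<Sum>p | p permutes {..<N}. of_int (sign p) * H (case_nat 0 (\<lambda>i. Suc (p i))))"
proof -
  let ?m = "map_permutation {..<N} Suc"
  have im: "bij_betw Suc {..<N} {Suc 0..<Suc N}"
    by (auto simp: bij_betw_def lessThan_atLeast0 image_Suc_atLeastLessThan)
  have im': "bij_betw (\<lambda>n. n - 1) {Suc 0..<Suc N} {..<N}"
    by (rule bij_betw_byWitness[where f' = Suc]) auto
  have app: "?m p = case_nat 0 (\<lambda>i. Suc (p i))" if "p permutes {..<N}" for p
  proof
    fix n show "?m p n = case_nat 0 (\<lambda>i. Suc (p i)) n"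
    proof (cases n)
      case 0
      have "?m p permutes {Suc 0..<Suc N}" by (rule map_permutation_permutes[OF im that])
      then show ?thesis using 0 by (simp add: permutes_def)
    next
      case (Suc m)
      show ?thesis
      proof (cases "m < N")
        case True then show ?thesis using Suc by (simp add: map_permutation_apply)
      next
        case False
        have "?m p permutes {Suc 0..<Suc N}" by (rule map_permutation_permutes[OF im that])
        then have "?m p n = n" using False Suc by (simp add: permutes_def)
        moreover have "p m = m" using that False by (simp add: permutes_def)
        ultimately show ?thesis using Suc by simp
      qed
    qed
  qed
  show ?thesis
  proof (rule sum.reindex_bij_witness[where i = ?m and j = "map_permutation {Suc 0..<Suc N} (\<lambda>n. n - 1)"])
    fix a assume a: "a \<in> {q. q permutes {Suc 0..<Suc N}}"
    show "?m (map_permutation {Suc 0..<Suc N} (\<lambda>n. n - 1) a) = a"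
      by (rule map_permutation_compose_inv[OF im']) (use a in auto)
    show b: "map_permutation {Suc 0..<Suc N} (\<lambda>n. n - 1) a \<in> {p. p permutes {..<N}}"
      using map_permutation_permutes[OF im'] a by simp
    have "H a = H (?m (map_permutation {Suc 0..<Suc N} (\<lambda>n. n - 1) a))"
      by (subst map_permutation_compose_inv[OF im']) (use a in auto)
    moreover have "sign (map_permutation {Suc 0..<Suc N} (\<lambda>n. n - 1) a) = sign a"
      by (rule sign_map_permutation) (use a im' in \<open>auto simp: bij_betw_def\<close>)
    ultimately show "of_int (sign (map_permutation {Suc 0..<Suc N} (\<lambda>n. n - 1) a)) *
      H (case_nat 0 (\<lambda>i. Suc (map_permutation {Suc 0..<Suc N} (\<lambda>n. n - 1) a i))) = of_int (sign a) * H a"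
      using app b by simp
  next
    fix b assume b: "b \<in> {p. p permutes {..<N}}"
    show "map_permutation {Suc 0..<Suc N} (\<lambda>n. n - 1) (?m b) = b"
      by (rule map_permutation_compose_inv[OF im]) (use b in auto)
    show "?m b \<in> {q. q permutes {Suc 0..<Suc N}}"
      using map_permutation_permutes[OF im] b by simp
  qed
qed

text \<open>Splits by the position \<open>b\<close> that is sent to 0. Writing the permutation as a stabiliser element
after the transposition of 0 and \<open>b\<close> (rather than before it) keeps track of the slot into which the
first vector is inserted.\<close>

lemma sum_permutes_split_first:
  fixes G :: "(nat \<Rightarrow> nat) \<Rightarrow> real"
  shows "(\<Sum>\<sigma> | \<sigma> permutes {..<Suc N}. G \<sigma>) =
    (\<Sum>b<Suc N. \<Sum>q | q permutes {Suc 0..<Suc N}. G (q \<circ> Transposition.transpose 0 b))"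
proof -
  let ?I = "inv_into UNIV :: (nat \<Rightarrow> nat) \<Rightarrow> nat \<Rightarrow> nat"
  have S: "{..<Suc N} = insert 0 {Suc 0..<Suc N}" by auto
  have inv_comp: "?I (Transposition.transpose 0 b \<circ> q) = ?I q \<circ> Transposition.transpose 0 b"
    if "q permutes {Suc 0..<Suc N}" for q b
    using permutes_bij[OF that] by (subst o_inv_distrib) auto
  have "(\<Sum>\<sigma> | \<sigma> permutes {..<Suc N}. G \<sigma>) = (\<Sum>\<sigma> | \<sigma> permutes {..<Suc N}. G (?I \<sigma>))"
    by (rule sum_permutations_inverse)
  also have "\<dots> = (\<Sum>b<Suc N. \<Sum>q | q permutes {Suc 0..<Suc N}. G (?I (Transposition.transpose 0 b \<circ> q)))"
    unfolding S by (rule sum_over_permutations_insert) auto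
  also have "\<dots> = (\<Sum>b<Suc N. \<Sum>q | q permutes {Suc 0..<Suc N}. G (?I q \<circ> Transposition.transpose 0 b))"
    by (intro sum.cong refl) (simp add: inv_comp)
  also have "\<dots> = (\<Sum>b<Suc N. \<Sum>q | q permutes {Suc 0..<Suc N}. G (q \<circ> Transposition.transpose 0 b))"
    by (intro sum.cong refl sum_permutations_inverse[symmetric])
  finally show ?thesis .
qed

lemma sum_lessThan_add: "(\<Sum>b<k + l. f b) = (\<Sum>b<k. f b) + (\<Sum>j<l. f (k + j))"
  for f :: "nat \<Rightarrow> real"
  by (induction l) (auto simp: algebra_simps)

text \<open>Contraction is an antiderivation. In the defining sum of \<open>\<alpha> \<and> \<beta>\<close> the vector \<open>x\<close> is inserted into
one of the \<open>k\<close> slots of \<open>\<alpha>\<close> or one of the \<open>l\<close> slots of \<open>\<beta>\<close>. Since the forms alternate, all slots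
of one factor contribute equally, which turns \<open>1 / (k! l!)\<close> into the normalisation of the smaller
wedge products. This rule reduces every evaluation below to shuffles instead of all permutations.\<close>

theorem contract_wedge:
  assumes A: "is_form k \<alpha>" and B: "is_form l \<beta>" and kl: "k + l = Suc N"
  shows "wedge k l \<alpha> \<beta> (case_nat x v) =
    (if k = 0 then 0 else wedge (k - 1) l (contract x \<alpha>) \<beta> v) +
    (if l = 0 then 0 else (-1) ^ k * wedge k (l - 1) \<alpha> (contract x \<beta>) v)"
proof -
  define w where "w = case_nat x v"
  define G where "G = (\<lambda>\<sigma>. of_int (sign \<sigma>) * \<alpha> (\<lambda>i. w (\<sigma> i)) * \<beta> (\<lambda>i. w (\<sigma> (k + i))))"
  define Q where "Q = {q. q permutes {Suc 0..<Suc N}}"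
  let ?tr = "Transposition.transpose :: nat \<Rightarrow> nat \<Rightarrow> nat \<Rightarrow> nat"
  have sgn: "sign (q \<circ> ?tr a b) = (if a = b then 1 else -1) * sign q"
    if "q permutes {..<Suc N}" for q a b
    using that permutation_permutes[of q]
    by (subst sign_compose) (auto simp: sign_swap_id permutation_swap_id)
  have Qsub: "q permutes {..<Suc N}" if "q \<in> Q" for q
    using that unfolding Q_def by (auto intro: permutes_subset)
  have Galpha: "G (q \<circ> ?tr a b) = G q"
    if q: "q permutes {..<Suc N}" and ab: "a < k" "b < k" for q a b
  proof (cases "a = b")
    case False
    have "\<alpha> (\<lambda>i. w (q (?tr a b i))) = - \<alpha> (\<lambda>i. w (q i))"
      using form_transpose[OF A ab False, of "\<lambda>i. w (q i)"] by simp
    moreover have "?tr a b (k + i) = k + i" for i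
      using ab by (auto simp: Transposition.transpose_def)
    ultimately show ?thesis using False by (simp add: G_def sgn[OF q])
  qed simp
  have Gbeta: "G (q \<circ> ?tr (k + a) (k + b)) = G q"
    if q: "q permutes {..<Suc N}" and ab: "a < l" "b < l" for q a b
  proof (cases "a = b")
    case False
    have "?tr (k + a) (k + b) (k + i) = k + ?tr a b i" for i
      by (auto simp: Transposition.transpose_def)
    then have "\<beta> (\<lambda>i. w (q (?tr (k + a) (k + b) (k + i)))) = - \<beta> (\<lambda>i. w (q (k + i)))"
      using form_transpose[OF B ab False, of "\<lambda>i. w (q (k + i))"] by simp
    moreover have "\<alpha> (\<lambda>i. w (q (?tr (k + a) (k + b) i))) = \<alpha> (\<lambda>i. w (q i))"
      by (intro form_cong[OF A]) (auto simp: Transposition.transpose_def)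
    ultimately show ?thesis using False by (simp add: G_def sgn[OF q])
  qed simp
  have wS: "w \<circ> case_nat 0 (\<lambda>i. Suc (p i)) = case_nat x (\<lambda>i. v (p i))" for p
    by (auto simp: fun_eq_iff w_def split: nat.splits)
  have first: "(\<Sum>q\<in>Q. G (q \<circ> ?tr 0 b)) = fact (k - 1) * fact l * wedge (k - 1) l (contract x \<alpha>) \<beta> v"
    if b: "b < k" for b
  proof -
    have k: "k = Suc (k - 1)" "(k - 1) + l = N" using b kl by auto
    have "(\<Sum>q\<in>Q. G (q \<circ> ?tr 0 b)) = (\<Sum>q\<in>Q. G q)"
      using b Qsub by (intro sum.cong refl Galpha) auto
    also have "\<dots> = (\<Sum>q\<in>Q. of_int (sign q) * (\<alpha> (\<lambda>i. w (q i)) * \<beta> (\<lambda>i. w (q (k + i)))))"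
      by (simp add: G_def mult.assoc)
    also have "\<dots> = (\<Sum>p | p permutes {..<N}. of_int (sign p) *
        (\<alpha> (case_nat x (\<lambda>i. v (p i))) * \<beta> (\<lambda>i. v (p ((k - 1) + i)))))"
      unfolding Q_def sum_permutes_Suc
    proof (intro sum.cong refl)
      fix p
      have "(\<lambda>i. w (case_nat 0 (\<lambda>i. Suc (p i)) i)) = case_nat x (\<lambda>i. v (p i))"
        using wS[of p] by (simp add: o_def)
      moreover have "w (case_nat 0 (\<lambda>i. Suc (p i)) (k + i)) = v (p ((k - 1) + i))" for i
        using b by (cases k) (simp_all add: w_def)
      ultimately show "real_of_int (sign p) * (\<alpha> (\<lambda>i. w (case_nat 0 (\<lambda>i. Suc (p i)) i)) *
          \<beta> (\<lambda>i. w (case_nat 0 (\<lambda>i. Suc (p i)) (k + i)))) =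
        real_of_int (sign p) * (\<alpha> (case_nat x (\<lambda>i. v (p i))) * \<beta> (\<lambda>i. v (p (k - 1 + i))))"
        by simp
    qed
    finally show ?thesis unfolding wedge_def contract_def k(2) by (simp add: mult.assoc)
  qed
  have second: "(\<Sum>q\<in>Q. G (q \<circ> ?tr 0 (k + j))) =
      (-1) ^ k * (fact k * fact (l - 1) * wedge k (l - 1) \<alpha> (contract x \<beta>) v)"
    if j: "j < l" for j
  proof -
    have l: "l = Suc (l - 1)" "k + (l - 1) = N" using j kl by auto
    have *: "(\<Sum>q\<in>Q. G (q \<circ> ?tr 0 (k + j))) = (\<Sum>q\<in>Q. G (q \<circ> ?tr 0 k))"
    proof (cases "k = 0 \<or> j = 0")
      case True
      have "G (q \<circ> ?tr 0 j) = G (q \<circ> ?tr 0 0)" if "q \<in> Q" "k = 0" for q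
        using Gbeta[OF Qsub[OF that(1)], of 0 j] j that(2) by simp
      then show ?thesis using True by (intro sum.cong refl) auto
    next
      case False
      \<comment> \<open>Slot \<open>k + j\<close> is reduced to slot \<open>k\<close> by conjugating with a transposition inside \<open>\<beta>\<close>.\<close>
      have p: "?tr k (k + j) permutes {Suc 0..<Suc N}"
        using False j kl by (intro permutes_swap_id) auto
      have eq: "?tr k (k + j) \<circ> ?tr 0 (k + j) = ?tr 0 k \<circ> ?tr k (k + j)"
        using False by (auto simp: fun_eq_iff Transposition.transpose_def)
      have "(\<Sum>q\<in>Q. G (q \<circ> ?tr 0 (k + j))) = (\<Sum>q\<in>Q. G ((q \<circ> ?tr k (k + j)) \<circ> ?tr 0 (k + j)))"
        unfolding Q_def by (rule sum_permutations_compose_right[OF p])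
      also have "\<dots> = (\<Sum>q\<in>Q. G ((q \<circ> ?tr 0 k) \<circ> ?tr (k + 0) (k + j)))"
        by (simp add: o_assoc[symmetric] eq)
      also have "\<dots> = (\<Sum>q\<in>Q. G (q \<circ> ?tr 0 k))"
      proof (intro sum.cong refl Gbeta)
        fix q assume "q \<in> Q"
        then show "q \<circ> ?tr 0 k permutes {..<Suc N}"
          using j kl by (intro permutes_compose[OF permutes_swap_id] Qsub) auto
      qed (use j in auto)
      finally show ?thesis .
    qed
    have step: "G (q \<circ> ?tr 0 k) = of_int (sign q) * ((-1) ^ k * (\<alpha> (\<lambda>i. w (q (Suc i))) *
        \<beta> (case_nat x (\<lambda>i. w (q (k + Suc i))))))" if q: "q \<in> Q" for q
    proof -
      have q0: "q 0 = 0" using q by (simp add: Q_def permutes_def)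
      have b: "\<beta> (\<lambda>i. w (q (?tr 0 k (k + i)))) = \<beta> (case_nat x (\<lambda>i. w (q (k + Suc i))))"
        by (intro arg_cong[where f = \<beta>])
          (auto simp: fun_eq_iff Transposition.transpose_def q0 w_def split: nat.splits)
      show ?thesis
      proof (cases k)
        case 0
        have "\<alpha> (\<lambda>i. w (q i)) = \<alpha> (\<lambda>i. w (q (Suc i)))"
          using 0 by (intro form_cong[OF A]) auto
        then show ?thesis using b 0 by (simp add: G_def)
      next
        case (Suc m)
        \<comment> \<open>\<open>\<alpha>\<close> receives the vector displaced from slot \<open>k\<close> in front; moving it behind the other
          \<open>k - 1\<close> arguments yields the sign \<open>(-1)\<^sup>k\<close> together with that of the transposition.\<close>
        have "\<alpha> (\<lambda>i. w (q (?tr 0 k i))) = \<alpha> ((\<lambda>i. w (q i))(0 := w (q k)))"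
          using Suc by (intro form_cong[OF A]) (auto simp: Transposition.transpose_def)
        also have "(-1) ^ m * \<dots> = \<alpha> (\<lambda>i. if i < m then w (q (Suc i)) else if i = m then w (q k) else w (q i))"
          using form_move[OF A, of m "\<lambda>i. w (q i)" "w (q k)"] Suc by simp
        also have "\<dots> = \<alpha> (\<lambda>i. w (q (Suc i)))"
          using Suc by (intro form_cong[OF A]) (auto simp: less_Suc_eq)
        finally have "\<alpha> (\<lambda>i. w (q (?tr 0 k i))) = (-1) ^ m * \<alpha> (\<lambda>i. w (q (Suc i)))"
          by (cases "even m") auto
        then show ?thesis using b Suc by (simp add: G_def sgn[OF Qsub[OF q]])
      qed
    qed
    have "(\<Sum>q\<in>Q. G (q \<circ> ?tr 0 k)) = (\<Sum>q\<in>Q. of_int (sign q) * ((-1) ^ k * (\<alpha> (\<lambda>i. w (q (Suc i))) *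
        \<beta> (case_nat x (\<lambda>i. w (q (k + Suc i)))))))"
      by (intro sum.cong refl step)
    also have "\<dots> = (\<Sum>p | p permutes {..<N}. of_int (sign p) * ((-1) ^ k * (\<alpha> (\<lambda>i. v (p i)) *
        \<beta> (case_nat x (\<lambda>i. v (p (k + i)))))))"
      unfolding Q_def sum_permutes_Suc by (simp add: w_def)
    also have "\<dots> = (-1) ^ k * (\<Sum>p | p permutes {..<N}. of_int (sign p) * \<alpha> (\<lambda>i. v (p i)) *
        \<beta> (case_nat x (\<lambda>i. v (p (k + i)))))"
      by (simp add: sum_distrib_left mult_ac)
    finally show ?thesis
      unfolding * wedge_def contract_def l(2) by simp
  qed
  have "(\<Sum>\<sigma> | \<sigma> permutes {..<k + l}. G \<sigma>) = (\<Sum>b<k + l. \<Sum>q\<in>Q. G (q \<circ> ?tr 0 b))"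
    unfolding kl Q_def by (rule sum_permutes_split_first)
  also have "\<dots> = (\<Sum>b<k. \<Sum>q\<in>Q. G (q \<circ> ?tr 0 b)) + (\<Sum>j<l. \<Sum>q\<in>Q. G (q \<circ> ?tr 0 (k + j)))"
    by (rule sum_lessThan_add)
  also have "\<dots> = of_nat k * (fact (k - 1) * fact l * wedge (k - 1) l (contract x \<alpha>) \<beta> v) +
      of_nat l * ((-1) ^ k * (fact k * fact (l - 1) * wedge k (l - 1) \<alpha> (contract x \<beta>) v))"
    by (simp add: first second)
  finally have "wedge k l \<alpha> \<beta> w = (of_nat k * (fact (k - 1) * fact l * wedge (k - 1) l (contract x \<alpha>) \<beta> v) +
      of_nat l * ((-1) ^ k * (fact k * fact (l - 1) * wedge k (l - 1) \<alpha> (contract x \<beta>) v))) / (fact k * fact l)"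
    by (simp add: wedge_def G_def)
  moreover have "of_nat k * (fact (k - 1) * fact l * z) / (fact k * fact l) = (if k = 0 then 0 else z)" for z :: real
    by (cases k) (auto simp: divide_simps)
  moreover have "of_nat l * (c * (fact k * fact (l - 1) * z)) / (fact k * fact l) = (if l = 0 then 0 else c * z)" for c z :: real
    by (cases l) (auto simp: divide_simps)
  ultimately show ?thesis by (simp add: w_def add_divide_distrib)
qed

section \<open>Evaluation of the bilinear form of a 3-form\<close>

text \<open>Arguments of a form are written \<open>(!) [x, y, \<dots>]\<close>; contraction then conses a vector to the list, and
the antiderivation rule becomes a recursion over the list.\<close>

lemma nth_Cons_case_nat: "(!) (x # xs) = case_nat x ((!) xs)"
  by (auto simp: fun_eq_iff split: nat.splits)

lemma contract_nth: "contract x \<omega> ((!) xs) = \<omega> ((!) (x # xs))"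
  by (simp add: contract_def nth_Cons_case_nat)

lemma wedge_0_0: "is_form 0 \<alpha> \<Longrightarrow> is_form 0 \<beta> \<Longrightarrow> wedge 0 0 \<alpha> \<beta> v = \<alpha> v * \<beta> v"
  by (simp add: wedge_def)

lemma wedge_nth_Cons:
  "is_form (Suc k) \<alpha> \<Longrightarrow> is_form (Suc l) \<beta> \<Longrightarrow> wedge (Suc k) (Suc l) \<alpha> \<beta> ((!) (x # xs)) =
    wedge k (Suc l) (contract x \<alpha>) \<beta> ((!) xs) - (-1) ^ k * wedge (Suc k) l \<alpha> (contract x \<beta>) ((!) xs)"
  "is_form (Suc k) \<alpha> \<Longrightarrow> is_form 0 \<beta> \<Longrightarrow> wedge (Suc k) 0 \<alpha> \<beta> ((!) (x # xs)) =
    wedge k 0 (contract x \<alpha>) \<beta> ((!) xs)"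
  "is_form 0 \<alpha> \<Longrightarrow> is_form (Suc l) \<beta> \<Longrightarrow> wedge 0 (Suc l) \<alpha> \<beta> ((!) (x # xs)) =
    wedge 0 l \<alpha> (contract x \<beta>) ((!) xs)"
  unfolding nth_Cons_case_nat
  by (simp_all add: contract_wedge[where N = "k + Suc l"] contract_wedge[where N = k] contract_wedge[where N = l])

lemmas wedge_eval = wedge_nth_Cons wedge_0_0 is_form_contract contract_nth

lemma wedge_2_2:
  assumes "is_form 2 \<alpha>" "is_form 2 \<beta>"
  shows "wedge 2 2 \<alpha> \<beta> ((!) [a, b, c, d]) =
    \<alpha> ((!) [a, b]) * \<beta> ((!) [c, d]) - \<alpha> ((!) [a, c]) * \<beta> ((!) [b, d])
    + \<alpha> ((!) [a, d]) * \<beta> ((!) [b, c])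
    + \<alpha> ((!) [b, c]) * \<beta> ((!) [a, d])
    - \<alpha> ((!) [b, d]) * \<beta> ((!) [a, c])
    + \<alpha> ((!) [c, d]) * \<beta> ((!) [a, b])"
  using assms by (simp add: numeral_eq_Suc wedge_eval)

lemma wedge_4_3:
  assumes "is_form 4 \<alpha>" "is_form 3 \<beta>"
  shows "wedge 4 3 \<alpha> \<beta> ((!) [a, b, c, d, e, f, g]) =
    \<alpha> ((!) [a, b, c, d]) * \<beta> ((!) [e, f, g])
    - \<alpha> ((!) [a, b, c, e]) * \<beta> ((!) [d, f, g])
    + \<alpha> ((!) [a, b, c, f]) * \<beta> ((!) [d, e, g])
    - \<alpha> ((!) [a, b, c, g]) * \<beta> ((!) [d, e, f])
    + \<alpha> ((!) [a, b, d, e]) * \<beta> ((!) [c, f, g])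
    - \<alpha> ((!) [a, b, d, f]) * \<beta> ((!) [c, e, g])
    + \<alpha> ((!) [a, b, d, g]) * \<beta> ((!) [c, e, f])
    + \<alpha> ((!) [a, b, e, f]) * \<beta> ((!) [c, d, g])
    - \<alpha> ((!) [a, b, e, g]) * \<beta> ((!) [c, d, f])
    + \<alpha> ((!) [a, b, f, g]) * \<beta> ((!) [c, d, e])
    - \<alpha> ((!) [a, c, d, e]) * \<beta> ((!) [b, f, g])
    + \<alpha> ((!) [a, c, d, f]) * \<beta> ((!) [b, e, g])
    - \<alpha> ((!) [a, c, d, g]) * \<beta> ((!) [b, e, f])
    - \<alpha> ((!) [a, c, e, f]) * \<beta> ((!) [b, d, g])
    + \<alpha> ((!) [a, c, e, g]) * \<beta> ((!) [b, d, f])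
    - \<alpha> ((!) [a, c, f, g]) * \<beta> ((!) [b, d, e])
    + \<alpha> ((!) [a, d, e, f]) * \<beta> ((!) [b, c, g])
    - \<alpha> ((!) [a, d, e, g]) * \<beta> ((!) [b, c, f])
    + \<alpha> ((!) [a, d, f, g]) * \<beta> ((!) [b, c, e])
    - \<alpha> ((!) [a, e, f, g]) * \<beta> ((!) [b, c, d])
    + \<alpha> ((!) [b, c, d, e]) * \<beta> ((!) [a, f, g])
    - \<alpha> ((!) [b, c, d, f]) * \<beta> ((!) [a, e, g])
    + \<alpha> ((!) [b, c, d, g]) * \<beta> ((!) [a, e, f])
    + \<alpha> ((!) [b, c, e, f]) * \<beta> ((!) [a, d, g])
    - \<alpha> ((!) [b, c, e, g]) * \<beta> ((!) [a, d, f])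
    + \<alpha> ((!) [b, c, f, g]) * \<beta> ((!) [a, d, e])
    - \<alpha> ((!) [b, d, e, f]) * \<beta> ((!) [a, c, g])
    + \<alpha> ((!) [b, d, e, g]) * \<beta> ((!) [a, c, f])
    - \<alpha> ((!) [b, d, f, g]) * \<beta> ((!) [a, c, e])
    + \<alpha> ((!) [b, e, f, g]) * \<beta> ((!) [a, c, d])
    + \<alpha> ((!) [c, d, e, f]) * \<beta> ((!) [a, b, g])
    - \<alpha> ((!) [c, d, e, g]) * \<beta> ((!) [a, b, f])
    + \<alpha> ((!) [c, d, f, g]) * \<beta> ((!) [a, b, e])
    - \<alpha> ((!) [c, e, f, g]) * \<beta> ((!) [a, b, d])
    + \<alpha> ((!) [d, e, f, g]) * \<beta> ((!) [a, b, c])"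
  using assms by (simp add: numeral_eq_Suc wedge_eval)

text \<open>The coefficient of \<open>b\<^sub>\<phi>(E\<^sub>p, E\<^sub>q)\<close> in a frame as a cubic polynomial in the coefficients
\<open>a i j k = \<phi>(E\<^sub>i, E\<^sub>j, E\<^sub>k)\<close>. The local \<open>w\<close> is the 4-form \<open>\<iota>\<^sub>p\<phi> \<and> \<iota>\<^sub>q\<phi>\<close>, and the sum runs over the 35
shuffles of 4 and 3 indices.\<close>

definition b_poly :: "(nat \<Rightarrow> nat \<Rightarrow> nat \<Rightarrow> real) \<Rightarrow> nat \<Rightarrow> nat \<Rightarrow> real" where
  "b_poly a p q = (let w = (\<lambda>i j k l. a p i j * a q k l - a p i k * a q j l + a p i l * a q j k
        + a p j k * a q i l - a p j l * a q i k + a p k l * a q i j) in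
    w 1 2 3 4 * a 5 6 7 - w 1 2 3 5 * a 4 6 7 + w 1 2 3 6 * a 4 5 7 - w 1 2 3 7 * a 4 5 6
    + w 1 2 4 5 * a 3 6 7 - w 1 2 4 6 * a 3 5 7 + w 1 2 4 7 * a 3 5 6 + w 1 2 5 6 * a 3 4 7
    - w 1 2 5 7 * a 3 4 6 + w 1 2 6 7 * a 3 4 5 - w 1 3 4 5 * a 2 6 7 + w 1 3 4 6 * a 2 5 7
    - w 1 3 4 7 * a 2 5 6 - w 1 3 5 6 * a 2 4 7 + w 1 3 5 7 * a 2 4 6 - w 1 3 6 7 * a 2 4 5
    + w 1 4 5 6 * a 2 3 7 - w 1 4 5 7 * a 2 3 6 + w 1 4 6 7 * a 2 3 5 - w 1 5 6 7 * a 2 3 4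
    + w 2 3 4 5 * a 1 6 7 - w 2 3 4 6 * a 1 5 7 + w 2 3 4 7 * a 1 5 6 + w 2 3 5 6 * a 1 4 7
    - w 2 3 5 7 * a 1 4 6 + w 2 3 6 7 * a 1 4 5 - w 2 4 5 6 * a 1 3 7 + w 2 4 5 7 * a 1 3 6
    - w 2 4 6 7 * a 1 3 5 + w 2 5 6 7 * a 1 3 4 + w 3 4 5 6 * a 1 2 7 - w 3 4 5 7 * a 1 2 6
    + w 3 4 6 7 * a 1 2 5 - w 3 5 6 7 * a 1 2 4 + w 4 5 6 7 * a 1 2 3) / 6"

lemma b_form_frame:
  assumes "is_form 3 \<phi>"
  shows "b_form \<phi> (E p) (E q) ((!) [E 1, E 2, E 3, E 4, E 5, E 6, E 7]) =
    b_poly (\<lambda>i j k. \<phi> ((!) [E i, E j, E k])) p q"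
proof -
  have c: "is_form 2 (contract x \<phi>)" for x
    using is_form_contract[of 2 \<phi> x] assms by (simp add: eval_nat_numeral)
  have "is_form 4 (wedge 2 2 (contract x \<phi>) (contract y \<phi>))" for x y
    using is_form_wedge[OF c c] by simp
  then show ?thesis
    unfolding b_form_def b_poly_def Let_def
    by (simp only: wedge_4_3 assms wedge_2_2[OF c c] contract_nth)
qed

lemma is_form_divide: "is_form k \<omega> \<Longrightarrow> is_form k (\<lambda>v. \<omega> v / c)"
  unfolding is_form_def linear_iff by (simp add: add_divide_distrib)

lemma is_form_b_form:
  assumes "is_form 3 \<phi>"
  shows "is_form 7 (b_form \<phi> x y)"
proof -
  have c: "is_form 2 (contract x \<phi>)" for x
    using is_form_contract[of 2 \<phi> x] assms by (simp add: eval_nat_numeral)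
  have "is_form (2 + 2 + 3) (wedge (2 + 2) 3 (wedge 2 2 (contract x \<phi>) (contract y \<phi>)) \<phi>)" for x y
    by (intro is_form_wedge c assms)
  then have "is_form 7 (wedge 4 3 (wedge 2 2 (contract x \<phi>) (contract y \<phi>)) \<phi>)"
    by simp
  then show ?thesis
    unfolding b_form_def by (rule is_form_divide)
qed

lemma b_form_sym:
  assumes "is_form 3 \<phi>"
  shows "b_form \<phi> x y = b_form \<phi> y x"
proof -
  have c: "is_form 2 (contract x \<phi>)" for x
    using is_form_contract[of 2 \<phi> x] assms by (simp add: eval_nat_numeral)
  have "wedge 2 2 (contract x \<phi>) (contract y \<phi>) v = wedge 2 2 (contract y \<phi>) (contract x \<phi>) v" for v
  proof -
    have *: "wedge 2 2 (contract x \<phi>) (contract y \<phi>) v =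
        wedge 2 2 (contract x \<phi>) (contract y \<phi>) ((!) [v 0, v 1, v 2, v 3])" for x y
      by (rule form_cong[OF is_form_wedge[OF c c]])
        (auto simp: numeral_eq_Suc less_Suc_eq)
    show ?thesis unfolding * wedge_2_2[OF c c] by simp
  qed
  then have "wedge 2 2 (contract x \<phi>) (contract y \<phi>) = wedge 2 2 (contract y \<phi>) (contract x \<phi>)" ..
  then show ?thesis by (simp add: b_form_def)
qed

lemma linear_wedge_left:
  assumes "\<And>v. linear (\<lambda>x. \<alpha> x v)"
  shows "linear (\<lambda>x. wedge k l (\<alpha> x) \<beta> v)"
proof -
  have "linear (\<lambda>x. of_int (sign \<sigma>) * \<alpha> x (\<lambda>i. v (\<sigma> i)) * \<beta> (\<lambda>i. v (\<sigma> (k + i))))" for \<sigma>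
    using assms[of "\<lambda>i. v (\<sigma> i)"] by (simp add: linear_iff algebra_simps)
  then have "linear (\<lambda>x. \<Sum>\<sigma> | \<sigma> permutes {..<k + l}.
      of_int (sign \<sigma>) * \<alpha> x (\<lambda>i. v (\<sigma> i)) * \<beta> (\<lambda>i. v (\<sigma> (k + i))))"
    by (intro linear_compose_sum) auto
  then show ?thesis unfolding wedge_def by (simp add: linear_iff add_divide_distrib)
qed

lemma bilinear_b_form:
  assumes "is_form 3 \<phi>"
  shows "bilinear (\<lambda>x y. b_form \<phi> x y v)"
proof -
  have "linear (\<lambda>x. contract x \<phi> v)" for v
  proof -
    have "(\<lambda>x. \<phi> (case_nat x v)) = (\<lambda>x. \<phi> ((case_nat 0 v)(0 := x)))"
      by (intro ext arg_cong[where f = \<phi>]) (auto split: nat.splits)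
    then show ?thesis unfolding contract_def
      using form_linear[OF assms, of 0 "case_nat 0 v"] by simp
  qed
  then have "linear (\<lambda>x. wedge 4 3 (wedge 2 2 (contract x \<phi>) (contract y \<phi>)) \<phi> v)" for y
    by (intro linear_wedge_left)
  then have *: "linear (\<lambda>x. b_form \<phi> x y v)" for y
    unfolding b_form_def linear_iff by (simp add: add_divide_distrib)
  then have "linear (\<lambda>y. b_form \<phi> x y v)" for x
  proof -
    have "(\<lambda>y. b_form \<phi> x y v) = (\<lambda>y. b_form \<phi> y x v)"
      by (rule ext) (rule arg_cong[where f = "\<lambda>h. h v", OF b_form_sym[OF assms]])
    then show ?thesis using * by simp
  qed
  with * show ?thesis unfolding bilinear_def by blast
qed

section \<open>Frames and top-degree forms\<close>

lemma form_permute: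
  assumes A: "is_form k \<omega>" and p: "p permutes {..<k}"
  shows "\<omega> (\<lambda>i. v (p i)) = of_int (sign p) * \<omega> v"
proof -
  have "finite {..<k}" by simp
  with p show ?thesis
  proof (induction arbitrary: v rule: permutes_induct)
    case id
    then show ?case by simp
  next
    case (swap a b p)
    let ?t = "Transposition.transpose a b"
    have "\<omega> (\<lambda>i. v ((?t \<circ> p) i)) = of_int (sign p) * \<omega> (\<lambda>i. v (?t i))"
      using swap.IH[of "\<lambda>i. v (?t i)"] by simp
    also have "\<omega> (\<lambda>i. v (?t i)) = of_int (sign ?t) * \<omega> v"
      using form_transpose[OF A, of a b v] swap by (cases "a = b") (auto simp: sign_swap_id)
    finally show ?case
      using swap permutation_permutes[of p]
      by (subst sign_compose) (auto simp: permutation_swap_id)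
  qed
qed

lemma is_form_diff:
  assumes "is_form k \<alpha>" "is_form k \<beta>"
  shows "is_form k (\<lambda>v. \<alpha> v - c * \<beta> v)"
  unfolding is_form_def
proof (intro conjI allI impI)
  fix u v :: "nat \<Rightarrow> 'a" assume "\<forall>i<k. u i = v i"
  then have "\<alpha> u = \<alpha> v" "\<beta> u = \<beta> v"
    by (auto intro: form_cong[OF assms(1)] form_cong[OF assms(2)])
  then show "\<alpha> u - c * \<beta> u = \<alpha> v - c * \<beta> v" by simp
next
  fix v :: "nat \<Rightarrow> 'a" and i assume "i < k"
  from form_linear[OF assms(1) this, of v] form_linear[OF assms(2) this, of v]
  show "linear (\<lambda>x. \<alpha> (v(i := x)) - c * \<beta> (v(i := x)))"
    by (simp add: linear_iff algebra_simps)
next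
  fix v :: "nat \<Rightarrow> 'a" and i j assume "i < k" "j < k" "i \<noteq> j" "v i = v j"
  then have "\<alpha> v = 0" "\<beta> v = 0"
    by (rule form_eq_args[OF assms(1)], rule form_eq_args[OF assms(2)])
  then show "\<alpha> v - c * \<beta> v = 0" by simp
qed

text \<open>A basis \<open>E 1, \<dots>, E n\<close> of the space with its coordinate functions. This form of the hypothesis gives
finite-dimensional linear algebra on a type without a finiteness class.\<close>

locale frame =
  fixes n :: nat and e :: "nat \<Rightarrow> 'v::real_vector \<Rightarrow> real" and E :: "nat \<Rightarrow> 'v"
  assumes linear_coord: "i \<in> {1..n} \<Longrightarrow> linear (e i)"
    and coord_E: "i \<in> {1..n} \<Longrightarrow> j \<in> {1..n} \<Longrightarrow> e i (E j) = (if i = j then 1 else 0)"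
    and expand: "x = (\<Sum>i=1..n. e i x *\<^sub>R E i)"
begin

lemma linear_expand: "linear f \<Longrightarrow> f x = (\<Sum>i=1..n. e i x *\<^sub>R f (E i))"
  by (subst expand[of x]) (simp add: linear_sum linear_scale)

text \<open>One argument after the other is freed from the frame: a linear function that vanishes on the frame
vanishes on its span. When all arguments lie in the frame, either two agree or they are a
permutation of the frame.\<close>

lemma form_eq_0:
  assumes A: "is_form n \<omega>" and E0: "\<omega> (\<lambda>i. E (Suc i)) = 0"
  shows "\<omega> v = 0"
proof -
  let ?B = "E ` {1..n}"
  have span: "x \<in> span ?B" for x
    by (subst expand) (intro span_sum span_scale span_base, auto)
  have "\<omega> v = 0" if "k \<le> n" "\<And>i. k \<le> i \<Longrightarrow> i < n \<Longrightarrow> v i \<in> ?B" for k v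
    using that
  proof (induction k arbitrary: v)
    case 0
    then have "\<forall>i<n. \<exists>j\<in>{1..n}. v i = E j" by auto
    then obtain f where f: "\<And>i. i < n \<Longrightarrow> f i \<in> {1..n} \<and> v i = E (f i)" by metis
    define p where "p = (\<lambda>i. if i < n then f i - 1 else i)"
    have "Suc (p i) = f i" if "i < n" for i
      using f[OF that] that by (simp add: p_def)
    then have pv: "\<omega> v = \<omega> (\<lambda>i. E (Suc (p i)))"
      using f by (intro form_cong[OF A]) auto
    show ?case
    proof (cases "inj_on p {..<n}")
      case True
      have "p ` {..<n} \<subseteq> {..<n}" using f by (fastforce simp: p_def)
      then have "bij_betw p {..<n} {..<n}"
        using True by (simp add: bij_betw_def endo_inj_surj)
      then have "p permutes {..<n}"
        by (rule bij_imp_permutes) (simp add: p_def)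
      from form_permute[OF A this, of "\<lambda>i. E (Suc i)"] E0 pv show ?thesis
        by simp
    next
      case False
      then obtain i j where "i < n" "j < n" "i \<noteq> j" "p i = p j" by (auto simp: inj_on_def)
      then show ?thesis unfolding pv by (intro form_eq_args[OF A, of i j]) auto
    qed
  next
    case (Suc k)
    have lin: "linear (\<lambda>x. \<omega> (v(k := x)))" using Suc.prems(1) by (intro form_linear[OF A]) auto
    have "\<omega> (v(k := x)) = 0" if "x \<in> ?B" for x
      using Suc.prems that by (intro Suc.IH) auto
    then have "\<omega> (v(k := v k)) = 0"
      by (rule linear_eq_0_on_span[OF lin _ span])
    then show ?case by simp
  qed
  from this[of n v] show ?thesis by simp
qed

definition frame_det :: "(nat \<Rightarrow> 'v) \<Rightarrow> real" where
  "frame_det v = det (mat n n (\<lambda>(i, j). e (Suc j) (v i)))"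

lemma frame_det_E: "frame_det (\<lambda>i. E (Suc i)) = 1"
proof -
  have "mat n n (\<lambda>(i, j). e (Suc j) (E (Suc i))) = 1\<^sub>m n"
    by (rule eq_matI) (auto simp: coord_E)
  then show ?thesis by (simp add: frame_det_def)
qed

lemma is_form_frame_det: "is_form n frame_det"
proof -
  have D: "frame_det v = (\<Sum>p | p permutes {0..<n}. of_int (sign p) * (\<Prod>i\<in>{0..<n}. e (Suc (p i)) (v i)))" for v
    unfolding frame_det_def
    by (subst det_def'[of _ n])
      (auto intro!: sum.cong prod.cong dest: permutes_in_image)
  show ?thesis
    unfolding is_form_def
  proof (intro conjI allI impI)
    fix u v :: "nat \<Rightarrow> 'v" assume "\<forall>i<n. u i = v i"
    then show "frame_det u = frame_det v"
      unfolding D by (intro sum.cong refl arg_cong2[where f = "(*)"] prod.cong) auto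
  next
    fix v :: "nat \<Rightarrow> 'v" and k assume k: "k < n"
    have "linear (\<lambda>x. of_int (sign p) * (\<Prod>i\<in>{0..<n}. e (Suc (p i)) ((v(k := x)) i)))"
      if "p permutes {0..<n}" for p
    proof -
      have "p k < n" using permutes_in_image[OF that, of k] k by simp
      then have lin: "linear (e (Suc (p k)))" by (intro linear_coord) auto
      have "(\<Prod>i\<in>{0..<n}. e (Suc (p i)) ((v(k := x)) i)) =
          e (Suc (p k)) x * (\<Prod>i\<in>{0..<n} - {k}. e (Suc (p i)) (v i))" for x
        using k by (subst prod.remove[of _ k]) (auto intro!: prod.cong)
      then show ?thesis using lin by (simp add: linear_iff algebra_simps)
    qed
    then show "linear (\<lambda>x. frame_det (v(k := x)))"
      unfolding D by (intro linear_compose_sum) auto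
  next
    fix v :: "nat \<Rightarrow> 'v" and i j assume ij: "i < n" "j < n" "i \<noteq> j" "v i = v j"
    show "frame_det v = 0"
      unfolding frame_det_def
      by (rule det_identical_rows[of _ n i j]) (use ij in \<open>auto intro!: eq_vecI\<close>)
  qed
qed

text \<open>Top-degree forms form a line spanned by the determinant. For \<open>b\<^sub>\<phi>\<close> this separates the volume factor
from the Gram matrix.\<close>

lemma top_form:
  assumes A: "is_form n \<omega>"
  shows "\<omega> v = frame_det v * \<omega> (\<lambda>i. E (Suc i))"
proof -
  let ?c = "\<omega> (\<lambda>i. E (Suc i))"
  have "is_form n (\<lambda>v. \<omega> v - frame_det v * ?c)"
    using is_form_diff[OF A is_form_frame_det, of ?c] by (simp add: mult.commute)
  from form_eq_0[OF this, of v] show ?thesis by (simp add: frame_det_E)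
qed

end

text \<open>The basis dual to \<open>e\<close> is obtained from any basis \<open>B\<close> of the space: if the coordinates of \<open>B\<close> are
\<open>b\<^sup>* = \<Sum>\<^sub>i c\<^sub>b\<^sub>i e\<^sup>i\<close>, then \<open>E\<^sub>i = \<Sum>\<^sub>b c\<^sub>b\<^sub>i b\<close> expands every vector in the \<open>e\<^sup>i\<close>, and independence of the \<open>e\<^sup>i\<close>
gives \<open>e\<^sup>i(E\<^sub>j) = \<delta>\<^sub>i\<^sub>j\<close>.\<close>

lemma frame_of_dual_basis:
  fixes e :: "nat \<Rightarrow> 'v::real_vector \<Rightarrow> real"
  assumes dim: "dim (UNIV :: 'v set) \<noteq> 0" and e: "is_dual_basis n e"
  obtains E where "frame n e E"
proof -
  have lin: "linear (e i)" if "i \<in> {1..n}" for i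
    using e that unfolding is_dual_basis_def by (elim conjE) (rule bspec)
  have indep: "\<forall>i\<in>{1..n}. c i = 0" if "\<And>x. (\<Sum>i=1..n. c i * e i x) = 0" for c
    using e that unfolding is_dual_basis_def by simp
  have spanning: "\<exists>c. \<forall>x. \<alpha> x = (\<Sum>i=1..n. c i * e i x)" if "linear \<alpha>" for \<alpha> :: "'v \<Rightarrow> real"
    using e that unfolding is_dual_basis_def by simp
  define B where "B = extend_basis ({} :: 'v set)"
  have B: "independent B" "span B = UNIV"
    unfolding B_def by (simp_all add: independent_extend_basis independent_empty)
  have "card B = dim (UNIV :: 'v set)"
    using dim_eq_card[of B UNIV] B by simp
  then have fin: "finite B" using dim card.infinite by fastforce
  have rep: "x = (\<Sum>b\<in>B. representation B x b *\<^sub>R b)" for x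
    using sum_representation_eq[OF B(1), of x B] fin B by simp
  have "linear (\<lambda>x. representation B x b)" for b
    using B by (auto simp: linear_iff representation_add representation_scale)
  then have "\<exists>c. \<forall>x. representation B x b = (\<Sum>i=1..n. c i * e i x)" for b
    using spanning[of "\<lambda>x. representation B x b"] by simp
  then obtain c where c: "\<And>b x. representation B x b = (\<Sum>i=1..n. c b i * e i x)" by metis
  define E where "E i = (\<Sum>b\<in>B. c b i *\<^sub>R b)" for i
  have ex: "x = (\<Sum>i=1..n. e i x *\<^sub>R E i)" for x
  proof -
    have "x = (\<Sum>b\<in>B. (\<Sum>i=1..n. c b i * e i x) *\<^sub>R b)" using rep[of x] unfolding c .
    also have "\<dots> = (\<Sum>b\<in>B. \<Sum>i=1..n. (e i x * c b i) *\<^sub>R b)"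
      by (simp add: scaleR_sum_left mult.commute)
    also have "\<dots> = (\<Sum>i=1..n. \<Sum>b\<in>B. (e i x * c b i) *\<^sub>R b)" by (rule sum.swap)
    finally show ?thesis unfolding E_def scaleR_sum_right scaleR_scaleR .
  qed
  have dual: "e i (E j) = (if i = j then 1 else 0)" if ij: "i \<in> {1..n}" "j \<in> {1..n}" for i j
  proof -
    have "(\<Sum>k=1..n. (e i (E k) - (if k = i then 1 else 0)) * e k x) = 0" for x
    proof -
      have "e i x = (\<Sum>k=1..n. e k x * e i (E k))"
        using arg_cong[OF ex[of x], of "e i"]
        unfolding linear_sum[OF lin[OF ij(1)]] linear_scale[OF lin[OF ij(1)]] real_scaleR_def .
      moreover have "(\<Sum>k=1..n. (if k = i then 1 else 0) * e k x) = e i x"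
        using ij by (simp add: if_distrib[of "\<lambda>c. c * _"] cong: if_cong)
      moreover have "(\<Sum>k=1..n. (e i (E k) - (if k = i then 1 else 0)) * e k x) =
          (\<Sum>k=1..n. e k x * e i (E k)) - (\<Sum>k=1..n. (if k = i then 1 else 0) * e k x)"
        by (simp only: right_diff_distrib left_diff_distrib sum_subtractf mult.commute)
      ultimately show ?thesis by linarith
    qed
    then have "\<forall>k\<in>{1..n}. e i (E k) - (if k = i then 1 else 0) = 0"
      by (rule indep)
    then show ?thesis using ij by auto
  qed
  have "frame n e E"
  proof (rule frame.intro)
    show "linear (e i)" if "i \<in> {1..n}" for i using that by (rule lin)
    show "e i (E j) = (if i = j then 1 else 0)" if "i \<in> {1..n}" "j \<in> {1..n}" for i j
      using that by (rule dual)
    show "x = (\<Sum>i=1..n. e i x *\<^sub>R E i)" for x by (rule ex)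
  qed
  then show thesis by (rule that)
qed

section \<open>The pseudo-metric of a 3-form in a frame\<close>

context frame begin

definition gram :: "('v \<Rightarrow> 'v \<Rightarrow> real) \<Rightarrow> real mat" where
  "gram h = mat n n (\<lambda>(i, j). h (E (Suc i)) (E (Suc j)))"

lemma sum_index_shift: "(\<Sum>i=1..n. f i) = (\<Sum>i<n. f (Suc i))"
  by (rule sum.reindex_bij_witness[where i = Suc and j = "\<lambda>i. i - 1"]) auto

lemma bilinear_expand:
  assumes "bilinear h"
  shows "h x y = (\<Sum>i<n. \<Sum>j<n. e (Suc i) x * h (E (Suc i)) (E (Suc j)) * e (Suc j) y)"
proof -
  have l: "linear (\<lambda>x. h x y)" "linear (\<lambda>y. h x y)" for x y
    using assms by (auto simp: bilinear_def)
  have "h x y = (\<Sum>i<n. e (Suc i) x * h (E (Suc i)) y)" 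
    using linear_expand[OF l(1)[of y], of x] unfolding sum_index_shift by simp
  also have "\<dots> = (\<Sum>i<n. e (Suc i) x * (\<Sum>j<n. e (Suc j) y * h (E (Suc i)) (E (Suc j))))"
    unfolding linear_expand[OF l(2), of _ y] sum_index_shift by simp
  finally show ?thesis by (simp add: sum_distrib_left mult_ac)
qed

lemma det_gram_change:
  assumes "bilinear h"
  shows "det (mat n n (\<lambda>(i, j). h (v i) (v j))) = frame_det v ^ 2 * det (gram h)"
proof -
  let ?M = "mat n n (\<lambda>(i, j). e (Suc j) (v i))"
  have carr: "?M \<in> carrier_mat n n" "gram h \<in> carrier_mat n n" by (auto simp: gram_def)
  have "mat n n (\<lambda>(i, j). h (v i) (v j)) = ?M * gram h * ?M\<^sup>T"
  proof (rule eq_matI)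
    fix i j assume "i < dim_row (?M * gram h * ?M\<^sup>T)" "j < dim_col (?M * gram h * ?M\<^sup>T)"
    then have ij: "i < n" "j < n" by auto
    have "(?M * gram h * ?M\<^sup>T) $$ (i, j) =
        (\<Sum>k<n. (\<Sum>l<n. e (Suc l) (v i) * h (E (Suc l)) (E (Suc k))) * e (Suc k) (v j))"
      using ij by (simp add: gram_def scalar_prod_def atLeast0LessThan)
    also have "\<dots> = (\<Sum>k<n. \<Sum>l<n. e (Suc l) (v i) * h (E (Suc l)) (E (Suc k)) * e (Suc k) (v j))"
      by (simp only: sum_distrib_right)
    also have "\<dots> = (\<Sum>l<n. \<Sum>k<n. e (Suc l) (v i) * h (E (Suc l)) (E (Suc k)) * e (Suc k) (v j))"
      by (rule sum.swap)
    also have "\<dots> = h (v i) (v j)" by (rule bilinear_expand[OF assms, symmetric])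
    finally show "mat n n (\<lambda>(i, j). h (v i) (v j)) $$ (i, j) = (?M * gram h * ?M\<^sup>T) $$ (i, j)"
      using ij by simp
  qed (auto simp: gram_def)
  moreover have "det (?M * gram h * ?M\<^sup>T) = det ?M * det (gram h) * det ?M"
    using carr by (simp only: det_mult[of _ n] det_transpose[of _ n] mult_carrier_mat transpose_carrier_mat)
  ultimately show ?thesis by (simp add: frame_det_def power2_eq_square mult_ac)
qed

lemma det_gram_nonzero:
  assumes h: "bilinear h" and nd: "\<And>x. (\<And>y. h y x = 0) \<Longrightarrow> x = 0"
  shows "det (gram h) \<noteq> 0"
proof
  assume "det (gram h) = 0"
  then obtain c where c: "c \<in> carrier_vec n" "c \<noteq> 0\<^sub>v n" "gram h *\<^sub>v c = 0\<^sub>v n"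
    using det_0_iff_vec_prod_zero_field[of "gram h" n] by (auto simp: gram_def)
  define x where "x = (\<Sum>j<n. c $ j *\<^sub>R E (Suc j))"
  have cx: "e (Suc i) x = c $ i" if "i < n" for i
  proof -
    have l: "linear (e (Suc i))" using that by (intro linear_coord) auto
    have "e (Suc i) x = (\<Sum>j<n. c $ j * (if j = i then 1 else 0))"
      unfolding x_def linear_sum[OF l] using that
      by (intro sum.cong refl) (auto simp: linear_scale[OF l] coord_E)
    then show ?thesis using that by (simp add: if_distrib[of "\<lambda>t. _ * t"] cong: if_cong)
  qed
  have "h y x = 0" for y
  proof -
    have "(\<Sum>j<n. h (E (Suc i)) (E (Suc j)) * c $ j) = 0" if "i < n" for i
    proof -
      have "(gram h *\<^sub>v c) $ i = 0" using c that by simp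
      then show ?thesis using that c(1) by (simp add: gram_def scalar_prod_def atLeast0LessThan)
    qed
    then have "(\<Sum>j<n. e (Suc i) y * h (E (Suc i)) (E (Suc j)) * e (Suc j) x) = 0" if "i < n" for i
      using that by (simp add: cx mult.assoc sum_distrib_left[symmetric])
    then show ?thesis by (simp add: bilinear_expand[OF h, of y x])
  qed
  then have "x = 0" by (rule nd)
  then have "c $ i = 0" if "i < n" for i
    using cx[OF that] linear_0[OF linear_coord[of "Suc i"]] that by simp
  then have "c = 0\<^sub>v n" using c(1) by (intro eq_vecI) auto
  with c(2) show False by simp
qed

end

lemma frame_seq: "is_form 7 \<omega> \<Longrightarrow> \<omega> (\<lambda>i. E (Suc i)) = \<omega> ((!) [E 1, E 2, E 3, E 4, E 5, E 6, E 7])"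
  by (rule form_cong[of 7]) (auto simp: numeral_eq_Suc less_Suc_eq)

text \<open>Up to a nonzero constant \<open>g\<^sub>\<phi>\<close> is the polynomial form \<open>b\<^sub>\<phi>\<close> evaluated on the frame. On vectors \<open>v\<close> with
determinant \<open>D\<close> the Gram matrix of \<open>b\<^sub>\<phi>\<close> has determinant \<open>D\<^sup>7 D\<^sup>2\<close> times a constant, so its ninth root
is proportional to \<open>D\<close>, as is \<open>b\<^sub>\<phi>(x, y)(v)\<close>; their quotient does not depend on \<open>v\<close>.\<close>

lemma (in frame) g_form_eq:
  assumes n: "n = 7" and phi: "is_form 3 \<phi>"
    and nd: "\<forall>x. (\<forall>y v. b_form \<phi> x y v = 0) \<longrightarrow> x = 0"
  shows "\<exists>c. c \<noteq> 0 \<and>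
    (\<forall>x y. g_form \<phi> x y = b_form \<phi> x y ((!) [E 1, E 2, E 3, E 4, E 5, E 6, E 7]) / c)"
proof -
  let ?B = "\<lambda>x y. b_form \<phi> x y (\<lambda>i. E (Suc i))"
  have bil: "bilinear ?B" by (rule bilinear_b_form[OF phi])
  have b: "b_form \<phi> x y v = frame_det v * ?B x y" for x y v
    using top_form[of "b_form \<phi> x y" v] is_form_b_form[OF phi] n by simp
  have ndB: "x = 0" if "\<And>y. ?B y x = 0" for x
  proof (rule nd[rule_format])
    fix y v
    have "?B x y = 0" using that[of y] b_form_sym[OF phi, of x y] by simp
    then show "b_form \<phi> x y v = 0" unfolding b[of x y v] by simp
  qed
  define c where "c = root 9 (det (gram ?B))"
  have c: "c \<noteq> 0" unfolding c_def using det_gram_nonzero[OF bil ndB] by simp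
  have vol: "vol_form \<phi> v = frame_det v * c" for v
  proof -
    let ?D = "frame_det v"
    have "mat 7 7 (\<lambda>(i, j). b_form \<phi> (v i) (v j) v) = ?D \<cdot>\<^sub>m mat 7 7 (\<lambda>(i, j). ?B (v i) (v j))"
      by (rule eq_matI) (auto simp: b[of _ _ v])
    then have "det (mat 7 7 (\<lambda>(i, j). b_form \<phi> (v i) (v j) v)) = ?D ^ 7 * (?D ^ 2 * det (gram ?B))"
      using det_gram_change[OF bil, of v] n by simp
    also have "\<dots> = ?D ^ 9 * det (gram ?B)" by (simp add: power_add[symmetric] mult.assoc[symmetric])
    finally show ?thesis
      by (simp add: vol_form_def c_def real_root_mult odd_real_root_power_cancel)
  qed
  have "g_form \<phi> x y = ?B x y / c" for x y
    unfolding g_form_def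
  proof (rule the_equality)
    show "\<forall>v. ?B x y / c * vol_form \<phi> v = b_form \<phi> x y v"
    proof
      fix v
      show "?B x y / c * vol_form \<phi> v = b_form \<phi> x y v"
        using c unfolding vol b[of x y v] by simp
    qed
    fix d assume "\<forall>v. d * vol_form \<phi> v = b_form \<phi> x y v"
    then have "d * vol_form \<phi> (\<lambda>i. E (Suc i)) = ?B x y" by blast
    then show "d = ?B x y / c" using c by (simp add: vol frame_det_E field_simps)
  qed
  then show ?thesis
    using c frame_seq[OF is_form_b_form[OF phi], where E = E] by (intro exI[of _ c]) simp
qed

section \<open>Ricci curvature of unimodular Lie algebras\<close>

text \<open>The trace does not depend on the basis. Only the expansions of vectors are used, so the two index
sets may differ; one of them will be the basis chosen in the definition of the trace.\<close>

lemma trace_two_frames: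
  fixes f :: "'v::real_vector \<Rightarrow> 'v"
  assumes a: "\<And>i. i \<in> I \<Longrightarrow> linear (a i)" "\<And>x. x = (\<Sum>i\<in>I. a i x *\<^sub>R u i)"
    and b: "\<And>j. j \<in> J \<Longrightarrow> linear (b j)" "\<And>x. x = (\<Sum>j\<in>J. b j x *\<^sub>R w j)"
    and f: "linear f"
  shows "(\<Sum>i\<in>I. a i (f (u i))) = (\<Sum>j\<in>J. b j (f (w j)))"
proof -
  have "a i (f (u i)) = (\<Sum>j\<in>J. b j (u i) * a i (f (w j)))" if "i \<in> I" for i
    using arg_cong[OF b(2)[of "u i"], of "\<lambda>x. a i (f x)"]
    unfolding linear_sum[OF f] linear_sum[OF a(1)[OF that]] linear_scale[OF f]
      linear_scale[OF a(1)[OF that]] real_scaleR_def .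
  then have "(\<Sum>i\<in>I. a i (f (u i))) = (\<Sum>i\<in>I. \<Sum>j\<in>J. b j (u i) * a i (f (w j)))"
    by (rule sum.cong[OF refl])
  also have "\<dots> = (\<Sum>j\<in>J. \<Sum>i\<in>I. b j (u i) * a i (f (w j)))" by (rule sum.swap)
  also have "\<dots> = (\<Sum>j\<in>J. b j (f (w j)))"
  proof (rule sum.cong[OF refl])
    fix j assume j: "j \<in> J"
    have "b j (f (w j)) = (\<Sum>i\<in>I. a i (f (w j)) * b j (u i))"
      using arg_cong[OF a(2)[of "f (w j)"], of "b j"]
      unfolding linear_sum[OF b(1)[OF j]] linear_scale[OF b(1)[OF j]] real_scaleR_def .
    then show "(\<Sum>i\<in>I. b j (u i) * a i (f (w j))) = b j (f (w j))"
      by (simp only: mult.commute)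
  qed
  finally show ?thesis .
qed

context frame begin

definition tr :: "('v \<Rightarrow> 'v) \<Rightarrow> real" where
  "tr f = (\<Sum>i=1..n. e i (f (E i)))"

lemma span_E: "span (E ` {1..n}) = UNIV"
proof -
  have "x \<in> span (E ` {1..n})" for x
    by (subst expand) (intro span_sum span_scale span_base, auto)
  then show ?thesis by auto
qed

lemma endo_trace_eq:
  assumes "linear f"
  shows "endo_trace f = tr f"
proof -
  define B where "B = extend_basis ({} :: 'v set)"
  have B: "independent B" "span B = UNIV"
    unfolding B_def by (simp_all add: independent_extend_basis independent_empty)
  have fin: "finite B"
    using independent_span_bound[OF _ B(1), of "E ` {1..n}"] unfolding span_E by simp
  have rep: "x = (\<Sum>b\<in>B. representation B x b *\<^sub>R b)" for x
    using sum_representation_eq[OF B(1), of x B] fin B by simp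
  have lin: "linear (\<lambda>x. representation B x b)" for b
    using B by (auto simp: linear_iff representation_add representation_scale)
  have "(\<Sum>b\<in>B. representation B (f b) b) = (\<Sum>i\<in>{1..n}. e i (f (E i)))"
    by (rule trace_two_frames[OF lin rep linear_coord expand assms])
  then show ?thesis by (simp add: endo_trace_def tr_def B_def)
qed

lemma coord_sum: "i \<in> {1..n} \<Longrightarrow> e i (sum f A) = (\<Sum>a\<in>A. e i (f a))"
  by (rule linear_sum[OF linear_coord])

lemma tr_add: "tr (\<lambda>z. f z + h z) = tr f + tr h"
  unfolding tr_def sum.distrib[symmetric] by (intro sum.cong refl linear_add linear_coord)

lemma tr_diff: "tr (\<lambda>z. f z - h z) = tr f - tr h"
  unfolding tr_def sum_subtractf[symmetric] by (intro sum.cong refl linear_diff linear_coord)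

lemma tr_scale: "tr (\<lambda>z. c *\<^sub>R f z) = c * tr f"
  unfolding tr_def sum_distrib_left
  by (intro sum.cong refl) (simp add: linear_scale[OF linear_coord])

lemma tr_rank_one: "linear \<alpha> \<Longrightarrow> tr (\<lambda>z. \<alpha> z *\<^sub>R v) = \<alpha> v"
proof -
  assume a: "linear \<alpha>"
  have "tr (\<lambda>z. \<alpha> z *\<^sub>R v) = (\<Sum>i=1..n. e i v * \<alpha> (E i))"
    unfolding tr_def by (intro sum.cong refl) (simp add: linear_scale[OF linear_coord])
  also have "\<dots> = \<alpha> v" using linear_expand[OF a, of v] by simp
  finally show ?thesis .
qed

lemma tr_commute:
  assumes f: "linear f" and h: "linear h"
  shows "tr (\<lambda>z. f (h z)) = tr (\<lambda>z. h (f z))"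
proof -
  have *: "tr (\<lambda>z. f (h z)) = (\<Sum>i=1..n. \<Sum>j=1..n. e j (h (E i)) * e i (f (E j)))"
    if f: "linear f" for f h :: "'v \<Rightarrow> 'v"
    unfolding tr_def
  proof (rule sum.cong[OF refl])
    fix i assume i: "i \<in> {1..n}"
    show "e i (f (h (E i))) = (\<Sum>j=1..n. e j (h (E i)) * e i (f (E j)))"
      unfolding linear_expand[OF f, of "h (E i)"] coord_sum[OF i]
      by (intro sum.cong refl) (simp add: linear_scale[OF linear_coord[OF i]])
  qed
  show ?thesis
    unfolding *[OF f] *[OF h] by (subst sum.swap) (simp only: mult.commute)
qed

end

locale metric_lie_algebra = frame n e E for n :: nat and e :: "nat \<Rightarrow> 'v::real_vector \<Rightarrow> real" and E +
  fixes br :: "'v \<Rightarrow> 'v \<Rightarrow> 'v" and g :: "'v \<Rightarrow> 'v \<Rightarrow> real"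
  assumes lie: "lie_algebra br" and metric: "pseudo_metric g"
begin

lemma bilinear_br: "bilinear br" and br_self: "br x x = 0"
  using lie by (auto simp: lie_algebra_def)

lemma br_minus: "br y x = - br x y"
proof -
  have "br (x + y) (x + y) = br x y + br y x"
    using bilinear_br by (simp only: bilinear_ladd bilinear_radd) (simp add: br_self add.commute)
  then show ?thesis by (simp add: br_self eq_neg_iff_add_eq_0 add.commute)
qed

lemma bilinear_g: "bilinear g" and g_sym: "g x y = g y x"
  and g_nondeg: "(\<And>y. g x y = 0) \<Longrightarrow> x = 0"
  using metric by (auto simp: pseudo_metric_def)

lemmas g_simps = bilinear_ladd[OF bilinear_g] bilinear_radd[OF bilinear_g] bilinear_lsub[OF bilinear_g]
  bilinear_rsub[OF bilinear_g] bilinear_lmul[OF bilinear_g] bilinear_rmul[OF bilinear_g]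
  bilinear_lneg[OF bilinear_g] bilinear_rneg[OF bilinear_g] bilinear_lzero[OF bilinear_g] bilinear_rzero[OF bilinear_g]

lemmas br_simps = bilinear_ladd[OF bilinear_br] bilinear_radd[OF bilinear_br] bilinear_lsub[OF bilinear_br]
  bilinear_rsub[OF bilinear_br] bilinear_lmul[OF bilinear_br] bilinear_rmul[OF bilinear_br]
  bilinear_lneg[OF bilinear_br] bilinear_rneg[OF bilinear_br] bilinear_lzero[OF bilinear_br] bilinear_rzero[OF bilinear_br]

lemma linear_g: "linear (g x)" "linear (\<lambda>y. g y x)"
  using bilinear_g by (auto simp: bilinear_def)

lemma g_eqI: "(\<And>z. g x z = g y z) \<Longrightarrow> x = y"
  using g_nondeg[of "x - y"] by (simp add: g_simps)

text \<open>The coordinates \<open>g(x, E\<^sub>i)\<close> define an injective linear endomorphism \<open>L\<close> by nondegeneracy. It maps a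
basis to an independent set of the same size, hence onto, and a preimage of the vector with
coordinates \<open>\<alpha>(E\<^sub>i)\<close> represents \<open>\<alpha>\<close>.\<close>

lemma riesz:
  assumes "linear \<alpha>"
  shows "\<exists>p. \<forall>x. g p x = \<alpha> x"
proof -
  define L where "L x = (\<Sum>i=1..n. g x (E i) *\<^sub>R E i)" for x
  have coord_L: "e i (L x) = g x (E i)" if i: "i \<in> {1..n}" for i x
  proof -
    have "e i (L x) = (\<Sum>j=1..n. g x (E j) * (if i = j then 1 else 0))"
      unfolding L_def coord_sum[OF i] using i
      by (intro sum.cong refl) (auto simp: linear_scale[OF linear_coord] coord_E)
    also have "\<dots> = g x (E i)"
      using i by (simp add: if_distrib[of "\<lambda>t. _ * t"] cong: if_cong)
    finally show ?thesis .
  qed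
  have "linear L"
    unfolding L_def by (intro linear_compose_sum ballI) (simp add: linear_iff g_simps scaleR_left_distrib)
  moreover have "x = 0" if "L x = 0" for x
  proof (rule g_nondeg)
    fix y
    have "g x (E i) = 0" if "i \<in> {1..n}" for i
      using coord_L[OF that, of x] \<open>L x = 0\<close> linear_0[OF linear_coord[OF that]] by simp
    then show "g x y = 0"
      unfolding linear_expand[OF linear_g(1)[of x], of y] by simp
  qed
  ultimately have injL: "inj L" by (simp add: linear_injective_0)
  have indE: "independent (E ` {1..n})"
  proof -
    have inj: "inj_on E {1..n}"
    proof (rule inj_onI)
      fix i j assume "i \<in> {1..n}" "j \<in> {1..n}" "E i = E j"
      then show "i = j" using coord_E[of i i] coord_E[of i j] by (auto split: if_splits)
    qed
    show "independent (E ` {1..n})"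
    proof (rule independent_if_scalars_zero)
      fix f x assume 0: "(\<Sum>x\<in>E ` {1..n}. f x *\<^sub>R x) = 0" and "x \<in> E ` {1..n}"
      then obtain i where i: "i \<in> {1..n}" "x = E i" by auto
      have "0 = e i (\<Sum>j=1..n. f (E j) *\<^sub>R E j)"
        using 0 linear_0[OF linear_coord[OF i(1)]] unfolding sum.reindex[OF inj] o_def by simp
      also have "\<dots> = (\<Sum>j=1..n. f (E j) * (if i = j then 1 else 0))"
        unfolding coord_sum[OF i(1)] using i
        by (intro sum.cong refl) (auto simp: linear_scale[OF linear_coord] coord_E)
      also have "\<dots> = f x" using i by (simp add: if_distrib[of "\<lambda>t. _ * t"] cong: if_cong)
      finally show "f x = 0" by simp
    qed simp
  qed
  let ?S = "L ` E ` {1..n}"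
  have indS: "independent ?S"
    by (rule linear_independent_injective_image[OF \<open>linear L\<close> indE inj_on_subset[OF injL subset_UNIV]])
  have "y \<in> span ?S" for y
  proof (rule ccontr)
    assume y: "y \<notin> span ?S"
    then have "independent (insert y ?S)" using indS by (simp add: independent_insert)
    then have "card (insert y ?S) \<le> card (E ` {1..n})"
      using independent_span_bound[of "E ` {1..n}" "insert y ?S"] unfolding span_E by simp
    moreover have "y \<notin> ?S" using y by (rule contrapos_nn) (rule span_base)
    moreover have "card ?S = card (E ` {1..n})"
      by (rule card_image) (rule inj_on_subset[OF injL], simp)
    ultimately show False by simp
  qed
  then have "span ?S = UNIV" by auto
  then have surj: "range L = UNIV"
    using linear_span_image[OF \<open>linear L\<close>, of "E ` {1..n}"] unfolding span_E by simp
  have "(\<Sum>i=1..n. \<alpha> (E i) *\<^sub>R E i) \<in> range L" unfolding surj by (rule UNIV_I)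
  then obtain p where p: "(\<Sum>i=1..n. \<alpha> (E i) *\<^sub>R E i) = L p" by (rule rangeE)
  have "g p x = \<alpha> x" for x
  proof -
    have "g p (E i) = \<alpha> (E i)" if i: "i \<in> {1..n}" for i
    proof -
      have "g p (E i) = e i (\<Sum>j=1..n. \<alpha> (E j) *\<^sub>R E j)"
        using coord_L[OF i, of p] unfolding p by simp
      also have "\<dots> = (\<Sum>j=1..n. \<alpha> (E j) * (if i = j then 1 else 0))"
        unfolding coord_sum[OF i] using i
        by (intro sum.cong refl) (auto simp: linear_scale[OF linear_coord] coord_E)
      also have "\<dots> = \<alpha> (E i)" using i by (simp add: if_distrib[of "\<lambda>t. _ * t"] cong: if_cong)
      finally show ?thesis .
    qed
    then show ?thesis
      unfolding linear_expand[OF linear_g(1)[of p], of x] linear_expand[OF assms, of x] by simp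
  qed
  then show ?thesis by (intro exI[of _ p] allI)
qed

text \<open>With the reciprocal basis \<open>E'\<^sub>i\<close> the trace of \<open>A\<close> is \<open>\<Sum>\<^sub>i g(E'\<^sub>i, A E\<^sub>i)\<close>, and also
\<open>\<Sum>\<^sub>i g(A E'\<^sub>i, E\<^sub>i)\<close>; skewness makes these two negatives of each other.\<close>

lemma tr_skew:
  assumes A: "linear A" and skew: "\<And>x y. g (A x) y + g x (A y) = 0"
  shows "tr A = 0"
proof -
  have "\<exists>p. \<forall>x. g p x = e i x" if "i \<in> {1..n}" for i
    by (rule riesz[OF linear_coord[OF that]])
  then have "\<forall>i\<in>{1..n}. \<exists>p. \<forall>x. g p x = e i x" by blast
  from bchoice[OF this] obtain E' where "\<forall>i\<in>{1..n}. \<forall>x. g (E' i) x = e i x" ..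
  then have E': "g (E' i) x = e i x" if "i \<in> {1..n}" for i x using that by blast
  have ex: "x = (\<Sum>i=1..n. g x (E i) *\<^sub>R E' i)" for x
  proof (rule g_eqI)
    fix z
    have "g (\<Sum>i=1..n. g x (E i) *\<^sub>R E' i) z = (\<Sum>i=1..n. e i z * g x (E i))"
      unfolding linear_sum[OF linear_g(2)] by (intro sum.cong refl) (simp add: g_simps E')
    also have "\<dots> = g x z"
      using linear_expand[OF linear_g(1)[of x], of z] by (simp only: real_scaleR_def)
    finally show "g x z = g (\<Sum>i=1..n. g x (E i) *\<^sub>R E' i) z" by simp
  qed
  have "tr A = (\<Sum>i=1..n. g (E' i) (A (E i)))" unfolding tr_def by (intro sum.cong refl) (simp add: E')
  also have "\<dots> = (\<Sum>i=1..n. - g (A (E' i)) (E i))"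
  proof (rule sum.cong[OF refl])
    fix i show "g (E' i) (A (E i)) = - g (A (E' i)) (E i)"
      using skew[of "E' i" "E i"] by linarith
  qed
  also have "\<dots> = - (\<Sum>i\<in>{1..n}. g (A (E' i)) (E i))" by (rule sum_negf)
  also have "(\<Sum>i\<in>{1..n}. g (A (E' i)) (E i)) = (\<Sum>i\<in>{1..n}. e i (A (E i)))"
    by (rule trace_two_frames[OF linear_g(2) ex linear_coord expand A])
  finally show ?thesis by (simp add: tr_def)
qed

abbreviation D where "D \<equiv> levi_civita br g"

lemma koszul_unique:
  assumes "is_levi_civita br g D'"
  shows "2 * g (D' x y) z = g (br x y) z - g (br y z) x + g (br z x) y"
proof -
  have t: "br x y = D' x y - D' y x" for x y using assms by (simp add: is_levi_civita_def)
  have m: "g y (D' x z) = - g (D' x y) z" for x y z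
    using assms by (simp add: is_levi_civita_def eq_neg_iff_add_eq_0 add.commute)
  have m': "g (D' x z) y = - g (D' x y) z" for x y z
    using m[of y x z] g_sym[of "D' x z" y] by simp
  show ?thesis unfolding t g_simps
    using m'[of x y z] m'[of y x z] m'[of z x y] by simp
qed

text \<open>The right-hand side of the Koszul formula is linear in \<open>z\<close>, hence represented by a vector, which defines
the connection.\<close>

lemma levi_civita: "is_levi_civita br g D"
proof -
  have "linear (\<lambda>z. (g (br x y) z - g (br y z) x + g (br z x) y) / 2)" for x y
    by (simp add: linear_iff g_simps br_simps field_simps)
  then have "\<exists>p. \<forall>z. g p z = (g (br x y) z - g (br y z) x + g (br z x) y) / 2" for x y
    by (rule riesz)
  then obtain D' where D': "\<And>x y z. g (D' x y) z = (g (br x y) z - g (br y z) x + g (br z x) y) / 2"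
    by metis
  have "bilinear D'"
    unfolding bilinear_def linear_iff
    by (intro conjI allI; rule g_eqI) (simp_all add: D' g_simps br_simps field_simps)
  moreover have "D' x y - D' y x = br x y" for x y
  proof (rule g_eqI)
    fix z show "g (D' x y - D' y x) z = g (br x y) z"
      unfolding g_simps D' by (simp add: br_minus[of y x] br_minus[of x z] br_minus[of z y] g_simps field_simps)
  qed
  moreover have "g (D' x y) z + g y (D' x z) = 0" for x y z
    unfolding g_sym[of y "D' x z"] D' by (simp add: br_minus[of y x] br_minus[of z x] br_minus[of z y] g_simps field_simps)
  ultimately have LC: "is_levi_civita br g D'" by (simp add: is_levi_civita_def)
  moreover have "D'' = D'" if "is_levi_civita br g D''" for D''
  proof (intro ext g_eqI)
    fix x y z show "g (D'' x y) z = g (D' x y) z"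
      using koszul_unique[OF that, of x y z] koszul_unique[OF LC, of x y z] by simp
  qed
  ultimately show ?thesis unfolding levi_civita_def by (rule theI)
qed

lemmas koszul = koszul_unique[OF levi_civita]

lemma bilinear_D: "bilinear D" and torsion_free: "D x y - D y x = br x y"
  and D_skew: "g (D x y) z + g y (D x z) = 0"
  using levi_civita by (auto simp: is_levi_civita_def)

lemma linear_D: "linear (D x)" "linear (\<lambda>z. D z x)"
  using bilinear_D by (auto simp: bilinear_def)

text \<open>Let \<open>P\<^sub>x\<close> be the endomorphism \<open>z \<mapsto> \<nabla>\<^sub>z x\<close>, so that \<open>P\<^sub>x = \<nabla>\<^sub>x - ad x\<close>. Its trace vanishes, since \<open>\<nabla>\<^sub>x\<close> is
skew and \<open>ad x\<close> is traceless. In the trace of \<open>z \<mapsto> R(z, x) y\<close> the first term is the trace of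
\<open>P\<close> at \<open>\<nabla>\<^sub>x y\<close>, and the other two combine to \<open>- tr (P\<^sub>y P\<^sub>x)\<close>.\<close>

theorem ricci_unimodular:
  assumes unimodular: "\<And>x. tr (br x) = 0"
  shows "ricci br g x y = - tr (\<lambda>z. D (D z x) y)"
proof -
  have Dsplit: "D z w = D w z - br w z" for z w
    using torsion_free[of w z] by (simp add: algebra_simps)
  have tr0: "tr (\<lambda>z. D z w) = 0" for w
  proof -
    have "tr (\<lambda>z. D z w) = tr (D w) - tr (br w)"
      unfolding tr_diff[symmetric] by (rule arg_cong[where f = tr]) (rule ext, rule Dsplit)
    also have "tr (D w) = 0" by (rule tr_skew[OF linear_D(1) D_skew])
    finally show ?thesis by (simp add: unimodular)
  qed
  have lin: "linear (\<lambda>z. D z (D x y) - D x (D z y) - D (br z x) y)"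
    using bilinear_br by (simp add: linear_iff bilinear_ladd[OF bilinear_D] bilinear_lmul[OF bilinear_D]
        bilinear_radd[OF bilinear_D] bilinear_rmul[OF bilinear_D] br_simps algebra_simps)
  have "ricci br g x y = tr (\<lambda>z. D z (D x y) - D x (D z y) - D (br z x) y)"
    unfolding ricci_def curvature_def Let_def by (rule endo_trace_eq[OF lin])
  also have "\<dots> = - tr (\<lambda>z. D x (D z y)) - tr (\<lambda>z. D (br z x) y)"
    by (simp add: tr_diff tr0)
  also have "tr (\<lambda>z. D x (D z y)) = tr (\<lambda>z. D (D x z) y)"
    by (rule tr_commute[OF linear_D])
  also have "- tr (\<lambda>z. D (D x z) y) - tr (\<lambda>z. D (br z x) y) = - tr (\<lambda>z. D (D x z) y + D (br z x) y)"
    by (simp add: tr_add)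
  also have "(\<lambda>z. D (D x z) y + D (br z x) y) = (\<lambda>z. D (D z x) y)"
    unfolding bilinear_ladd[OF bilinear_D, symmetric] using torsion_free[of _ x]
    by (simp add: diff_eq_eq add.commute)
  finally show ?thesis .
qed

text \<open>The differential of the 1-form \<open>g(c, _)\<close> is here the decomposable form \<open>g(p, _) \<and> g(r, _)\<close>. For central
\<open>c\<close> the Koszul formula then gives \<open>\<nabla>\<^sub>z c = (g(p, z) r - g(r, z) p) / 2\<close>, of rank at most two, and the
trace of the unimodular formula collapses to two Koszul terms.\<close>

theorem ricci_central:
  assumes unimodular: "\<And>x. tr (br x) = 0" and central: "\<And>x. br c x = 0"
    and dc: "\<And>x y. g c (br x y) = - (g p x * g r y - g p y * g r x)"
  shows "ricci br g c y = - g (br p r) y / 2"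
proof -
  have Dc: "D z c = (1/2) *\<^sub>R (g p z *\<^sub>R r - g r z *\<^sub>R p)" for z
  proof (rule g_eqI)
    fix w
    have "2 * g (D z c) w = g c (br w z)"
      using koszul[of z c w] central br_minus[of z c] g_sym[of "br w z" c] by (simp add: g_simps)
    then show "g (D z c) w = g ((1/2) *\<^sub>R (g p z *\<^sub>R r - g r z *\<^sub>R p)) w"
      by (simp add: dc g_simps mult.commute)
  qed
  have "(\<lambda>z. D (D z c) y) = (\<lambda>z. (1/2) *\<^sub>R (g p z *\<^sub>R D r y - g r z *\<^sub>R D p y))"
    unfolding Dc bilinear_lmul[OF bilinear_D] bilinear_lsub[OF bilinear_D] ..
  then have "tr (\<lambda>z. D (D z c) y) = (g p (D r y) - g r (D p y)) / 2"
    by (simp only: tr_scale tr_diff tr_rank_one[OF linear_g(1)])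
  then have "ricci br g c y = - (g p (D r y) - g r (D p y)) / 2"
    unfolding ricci_unimodular[OF unimodular] by simp
  moreover have "g p (D r y) - g r (D p y) = g (br p r) y"
    using koszul[of r y p] koszul[of p y r] g_sym[of p "D r y"] g_sym[of r "D p y"]
      br_minus[of y p] br_minus[of y r] br_minus[of r p] by (simp add: g_simps)
  ultimately show ?thesis by simp
qed

end

section \<open>The bilinear form of a closed 3-form\<close>

definition alternating :: "(nat \<Rightarrow> nat \<Rightarrow> nat \<Rightarrow> real) \<Rightarrow> bool" where
  "alternating a \<longleftrightarrow> (\<forall>i j k. a j i k = - a i j k \<and> a i k j = - a i j k)"

text \<open>Used as rewrite rules, the conditional equations sort numeral indices.\<close>

lemma alternating_sort:
  assumes "alternating a"
  shows "j < i \<Longrightarrow> a i j k = - a j i k" "k < j \<Longrightarrow> a i j k = - a i k j"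
    "a i i k = 0" "a i k k = 0" "a i k i = 0"
proof -
  have 1: "a j i k = - a i j k" and 2: "a i k j = - a i j k" for i j k
    using assms unfolding alternating_def by blast+
  show "a i j k = - a j i k" "a i j k = - a i k j" by (rule 1, rule 2)
  show "a i i k = 0" "a i k k = 0" using 1[of i i k] 2[of i k k] by linarith+
  then show "a i k i = 0" using 2[of i k i] by linarith
qed

text \<open>The solution of \<open>d\<phi> = 0\<close> for \<open>\<phi> = \<Sum> a i j k e\<^sup>i\<^sup>j\<^sup>k\<close> on the Lie algebra below: 17 coefficients in terms of
the remaining 18. Expressing \<open>a 1 5 7\<close> through \<open>a 3 4 5\<close> makes the latter a common factor of most
entries of \<open>b\<^sub>\<phi>\<close>.\<close>

definition closed_coeffs :: "(nat \<Rightarrow> nat \<Rightarrow> nat \<Rightarrow> real) \<Rightarrow> bool" where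
  "closed_coeffs a \<longleftrightarrow>
    a 1 5 7 = a 1 6 7 + a 2 3 7 - a 3 4 5 \<and>
    a 2 3 5 = a 1 3 7 - a 1 4 6 - a 1 4 7 \<and>
    a 2 4 5 = - (a 1 5 6) - a 1 6 7 - a 2 3 6 - a 2 3 7 + a 3 4 5 \<and>
    a 2 4 6 = - (a 1 6 7) - a 2 3 7 \<and>
    a 2 4 7 = a 1 6 7 \<and>
    a 2 5 6 = - 2 * a 1 6 7 \<and>
    a 2 5 7 = 0 \<and>
    a 2 6 7 = 0 \<and>
    a 3 4 6 = 0 \<and>
    a 3 4 7 = 0 \<and>
    a 3 5 6 = 0 \<and>
    a 3 5 7 = 0 \<and>
    a 3 6 7 = 0 \<and>
    a 4 5 6 = 0 \<and>
    a 4 5 7 = 0 \<and>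
    a 4 6 7 = 0 \<and>
    a 5 6 7 = 0"

text \<open>Rewriting with exactly these rules sorts indices and removes zero terms. The cancellation procedures
of the full simpset would be quadratic in the 210 monomials of \<open>b_poly\<close>.\<close>

lemmas index_less = numeral_less_iff one_less_numeral_iff not_numeral_less_one
  less_num_simps le_num_simps less_irrefl
lemmas drop_zero = mult_zero_left mult_zero_right add_0_left add_0_right diff_zero diff_0
  minus_zero mult_minus_left mult_minus_right minus_minus diff_minus_eq_add add_uminus_conv_diff

lemma clear_sixths: "(x / 6 = y / 2) = (x = 3 * y)" "(x / 6 = 0) = (x = 0)" for x y :: real
  by auto

text \<open>The entries that matter are the zeros: with respect to \<open>b\<^sub>\<phi>\<close> the vectors \<open>E 6\<close> and \<open>E 7\<close> are isotropic,
\<open>E 7\<close> is orthogonal to \<open>E 5\<close> and \<open>E 6\<close>, and its products with \<open>E 3\<close> and \<open>E 4\<close> are multiples of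
\<open>a 3 4 5 * a 1 6 7\<close>.\<close>

lemma b_poly_closed:
  assumes "alternating a" "closed_coeffs a"
  shows
    "b_poly a 2 3 = (- (a 1 2 6 * a 2 3 7 * a 3 4 5) + a 1 2 7 * a 2 3 6 * a 3 4 5
      + 2 * a 1 3 4 * a 1 6 7 * a 2 3 7 - a 1 3 5 * a 1 6 7 * a 2 3 6
      - a 1 3 5 * a 1 6 7 * a 2 3 7 - a 1 3 5 * a 2 3 7^2 + a 1 3 6 * a 1 3 7 * a 1 6 7
      - a 1 3 6 * a 1 4 6 * a 1 6 7 - a 1 3 6 * a 1 4 7 * a 1 6 7 + a 1 3 6 * a 1 5 6 * a 2 3 7
      + a 1 3 6 * a 1 6 7 * a 2 3 7 + a 1 3 6 * a 2 3 6 * a 2 3 7 + a 1 3 6 * a 2 3 7^2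
      - a 1 3 6 * a 2 3 7 * a 3 4 5 + a 1 3 7^2 * a 1 6 7 + a 1 3 7^2 * a 2 3 7
      - a 1 3 7 * a 1 4 6 * a 1 6 7 - a 1 3 7 * a 1 4 6 * a 2 3 7 - a 1 3 7 * a 1 4 7 * a 1 6 7
      - a 1 3 7 * a 1 4 7 * a 2 3 7 - a 1 3 7 * a 1 5 6 * a 2 3 6
      - 2 * a 1 3 7 * a 1 6 7 * a 2 3 4 - a 1 3 7 * a 1 6 7 * a 2 3 6 - a 1 3 7 * a 2 3 6^2
      - a 1 3 7 * a 2 3 6 * a 2 3 7 + a 1 3 7 * a 2 3 6 * a 3 4 5) / 2"
    "b_poly a 2 4 = (- (a 1 2 6 * a 1 6 7 * a 3 4 5) - a 1 2 7 * a 1 6 7 * a 3 4 5 - a 1 2 7 * a 2 3 7 * a 3 4 5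
      + 2 * a 1 3 4 * a 1 6 7^2 + a 1 3 7 * a 1 4 6 * a 1 6 7 + a 1 3 7 * a 1 4 7 * a 1 6 7
      + a 1 3 7 * a 1 4 7 * a 2 3 7 - a 1 4 5 * a 1 6 7 * a 2 3 6 - a 1 4 5 * a 1 6 7 * a 2 3 7
      - a 1 4 5 * a 2 3 7^2 - a 1 4 6^2 * a 1 6 7 - 2 * a 1 4 6 * a 1 4 7 * a 1 6 7
      - a 1 4 6 * a 1 4 7 * a 2 3 7 + a 1 4 6 * a 1 5 6 * a 2 3 7 + a 1 4 6 * a 1 6 7 * a 2 3 7
      + a 1 4 6 * a 2 3 6 * a 2 3 7 + a 1 4 6 * a 2 3 7^2 - a 1 4 6 * a 2 3 7 * a 3 4 5
      - a 1 4 7^2 * a 1 6 7 - a 1 4 7^2 * a 2 3 7 - a 1 4 7 * a 1 5 6 * a 2 3 6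
      - 2 * a 1 4 7 * a 1 6 7 * a 2 3 4 - a 1 4 7 * a 1 6 7 * a 2 3 6 - a 1 4 7 * a 2 3 6^2
      - a 1 4 7 * a 2 3 6 * a 2 3 7 + a 1 4 7 * a 2 3 6 * a 3 4 5) / 2"
    "b_poly a 2 5 = (- 2 * a 1 2 7 * a 1 6 7 * a 3 4 5 + 2 * a 1 3 5 * a 1 6 7^2 + a 1 3 7 * a 1 5 6 * a 1 6 7
      + a 1 3 7 * a 1 6 7^2 + 2 * a 1 3 7 * a 1 6 7 * a 2 3 7 - a 1 3 7 * a 1 6 7 * a 3 4 5
      + a 1 3 7 * a 2 3 7^2 - a 1 3 7 * a 2 3 7 * a 3 4 5 - 2 * a 1 4 5 * a 1 6 7 * a 2 3 7
      - a 1 4 6 * a 1 5 6 * a 1 6 7 - a 1 4 6 * a 1 6 7^2 - 2 * a 1 4 6 * a 1 6 7 * a 2 3 7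
      + a 1 4 6 * a 1 6 7 * a 3 4 5 - a 1 4 6 * a 2 3 7^2 + a 1 4 6 * a 2 3 7 * a 3 4 5
      - a 1 4 7 * a 1 5 6 * a 1 6 7 - a 1 4 7 * a 1 6 7^2 - 2 * a 1 4 7 * a 1 6 7 * a 2 3 7
      + a 1 4 7 * a 1 6 7 * a 3 4 5 - a 1 4 7 * a 2 3 7^2 + a 1 4 7 * a 2 3 7 * a 3 4 5
      + a 1 5 6^2 * a 2 3 7 - a 1 5 6 * a 1 6 7 * a 2 3 6 + a 1 5 6 * a 1 6 7 * a 2 3 7
      + a 1 5 6 * a 2 3 6 * a 3 4 5 + a 1 5 6 * a 2 3 7^2 - a 1 5 6 * a 2 3 7 * a 3 4 5
      - 2 * a 1 6 7^2 * a 2 3 4 - a 1 6 7^2 * a 2 3 6 - 2 * a 1 6 7 * a 2 3 4 * a 2 3 7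
      + 2 * a 1 6 7 * a 2 3 4 * a 3 4 5 - a 1 6 7 * a 2 3 6^2 - 2 * a 1 6 7 * a 2 3 6 * a 2 3 7
      + 2 * a 1 6 7 * a 2 3 6 * a 3 4 5 - a 2 3 6^2 * a 2 3 7 + a 2 3 6^2 * a 3 4 5
      - a 2 3 6 * a 2 3 7^2 + 2 * a 2 3 6 * a 2 3 7 * a 3 4 5 - a 2 3 6 * a 3 4 5^2) / 2"
    "b_poly a 2 6 = (2 * a 1 3 6 * a 1 6 7^2 + a 1 3 7 * a 1 6 7^2 + a 1 3 7 * a 1 6 7 * a 2 3 7
      - a 1 4 6 * a 1 6 7^2 - 3 * a 1 4 6 * a 1 6 7 * a 2 3 7 - a 1 4 7 * a 1 6 7^2
      - a 1 4 7 * a 1 6 7 * a 2 3 7 + a 1 5 6 * a 1 6 7 * a 2 3 7 + a 1 5 6 * a 2 3 7^2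
      - 2 * a 1 6 7^2 * a 2 3 4 - a 1 6 7^2 * a 2 3 6 - a 1 6 7 * a 2 3 6^2
      - a 1 6 7 * a 2 3 6 * a 2 3 7 + a 1 6 7 * a 2 3 6 * a 3 4 5) / 2"
    "b_poly a 2 7 = (a 1 3 7 * a 1 6 7^2 + a 1 4 6 * a 1 6 7^2 + a 1 4 7 * a 1 6 7^2
      - 2 * a 1 4 7 * a 1 6 7 * a 2 3 7 - a 1 5 6 * a 1 6 7 * a 2 3 7 + a 1 6 7^2 * a 2 3 6
      - a 1 6 7 * a 2 3 6 * a 3 4 5 + a 1 6 7 * a 2 3 7^2 + a 2 3 7^3 - a 2 3 7^2 * a 3 4 5) / 2"
    "b_poly a 3 3 = a 3 4 5 * (- 2 * a 1 3 6 * a 2 3 7 + 2 * a 1 3 7 * a 2 3 6) / 2"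
    "b_poly a 3 4 = a 3 4 5 * (- (a 1 3 6 * a 1 6 7) - a 1 3 7 * a 1 6 7 - a 1 3 7 * a 2 3 7 - a 1 4 6 * a 2 3 7
      + a 1 4 7 * a 2 3 6) / 2"
    "b_poly a 3 5 = a 3 4 5 * (- 2 * a 1 3 7 * a 1 6 7 - a 1 5 6 * a 2 3 7 + a 1 6 7 * a 2 3 6 + a 2 3 6 * a 2 3 7
      - a 2 3 6 * a 3 4 5) / 2"
    "b_poly a 3 6 = a 3 4 5 * a 1 6 7 * a 2 3 6 / 2"
    "b_poly a 3 7 = a 3 4 5 * a 1 6 7 * a 2 3 7 / 2"
    "b_poly a 4 4 = a 3 4 5 * (- 2 * a 1 4 6 * a 1 6 7 - 2 * a 1 4 7 * a 1 6 7 - 2 * a 1 4 7 * a 2 3 7) / 2"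
    "b_poly a 4 5 = a 3 4 5 * (- 2 * a 1 4 7 * a 1 6 7 - a 1 5 6 * a 1 6 7 - a 1 6 7^2 - 2 * a 1 6 7 * a 2 3 7
      + a 1 6 7 * a 3 4 5 - a 2 3 7^2 + a 2 3 7 * a 3 4 5) / 2"
    "b_poly a 4 6 = a 3 4 5 * (- (a 1 6 7^2) - a 1 6 7 * a 2 3 7) / 2"
    "b_poly a 4 7 = a 3 4 5 * a 1 6 7^2 / 2"
    "b_poly a 5 5 = a 3 4 5 * (- 4 * a 1 6 7^2 - 4 * a 1 6 7 * a 2 3 7 + 4 * a 1 6 7 * a 3 4 5) / 2"
    "b_poly a 5 6 = a 3 4 5 * (- 2 * a 1 6 7^2) / 2"
    "b_poly a 5 7 = 0"
    "b_poly a 6 6 = 0"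
    "b_poly a 6 7 = 0"
    "b_poly a 7 7 = 0"
  by (simp_all only: b_poly_def Let_def alternating_sort[OF assms(1)] index_less drop_zero
      clear_sixths assms(2)[unfolded closed_coeffs_def])
    (Groebner_Basis.algebra+)

text \<open>A vector in the span of \<open>E 3, \<dots>, E 7\<close> that is orthogonal to \<open>E 2, \<dots>, E 7\<close>. If \<open>b\<^sub>\<phi>\<close> is nondegenerate and
\<open>a 1 6 7 \<noteq> 0\<close>, it is the cross product of \<open>E 6\<close> and \<open>E 7\<close> up to scale, since for closed \<open>\<phi>\<close> the 1-form
\<open>\<phi>(E 6, E 7, _)\<close> is \<open>a 1 6 7 e\<^sup>1\<close>. Given its \<open>E 3\<close>-coefficient, orthogonality to \<open>E 7\<close>, \<open>E 6\<close>, \<open>E 5\<close>, \<open>E 4\<close>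
yields the other four coefficients in turn by back substitution, as long as \<open>a 3 4 5 * a 1 6 7 \<noteq> 0\<close>;
orthogonality to \<open>E 3\<close> and \<open>E 2\<close> then holds identically.\<close>

lemma b_poly_kernel:
  assumes "alternating a" "closed_coeffs a"
  obtains u4 u5 u6 u7 where
    "2 * a 1 6 7 ^ 3 * b_poly a 2 3 + u4 * b_poly a 2 4 + u5 * b_poly a 2 5
      + u6 * b_poly a 2 6 + u7 * b_poly a 2 7 = 0"
    "2 * a 1 6 7 ^ 3 * b_poly a 3 3 + u4 * b_poly a 3 4 + u5 * b_poly a 3 5
      + u6 * b_poly a 3 6 + u7 * b_poly a 3 7 = 0"
    "2 * a 1 6 7 ^ 3 * b_poly a 3 4 + u4 * b_poly a 4 4 + u5 * b_poly a 4 5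
      + u6 * b_poly a 4 6 + u7 * b_poly a 4 7 = 0"
    "2 * a 1 6 7 ^ 3 * b_poly a 3 5 + u4 * b_poly a 4 5 + u5 * b_poly a 5 5
      + u6 * b_poly a 5 6 + u7 * b_poly a 5 7 = 0"
    "2 * a 1 6 7 ^ 3 * b_poly a 3 6 + u4 * b_poly a 4 6 + u5 * b_poly a 5 6
      + u6 * b_poly a 6 6 + u7 * b_poly a 6 7 = 0"
    "2 * a 1 6 7 ^ 3 * b_poly a 3 7 + u4 * b_poly a 4 7 + u5 * b_poly a 5 7
      + u6 * b_poly a 6 7 + u7 * b_poly a 7 7 = 0"
proof -
  note closed = b_poly_closed[OF assms]
  define u4 where "u4 = - 2 * a 1 6 7^2 * a 2 3 7"
  define u5 where "u5 = a 1 6 7^2 * a 2 3 6 + a 1 6 7^2 * a 2 3 7 + a 1 6 7 * a 2 3 7^2"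
  define u6 where "u6 = - 2 * a 1 3 7 * a 1 6 7^2 + 2 * a 1 4 7 * a 1 6 7 * a 2 3 7 - a 1 6 7^2 * a 2 3 6
      - a 1 6 7^2 * a 2 3 7 - a 1 6 7 * a 2 3 6 * a 2 3 7 + a 1 6 7 * a 2 3 6 * a 3 4 5
      - 2 * a 1 6 7 * a 2 3 7^2 + a 1 6 7 * a 2 3 7 * a 3 4 5 - a 2 3 7^3 + a 2 3 7^2 * a 3 4 5"
  define u7 where "u7 = 2 * a 1 3 6 * a 1 6 7^2 - 2 * a 1 4 6 * a 1 6 7 * a 2 3 7 + a 1 5 6 * a 1 6 7 * a 2 3 6
      + a 1 5 6 * a 1 6 7 * a 2 3 7 + a 1 5 6 * a 2 3 7^2"
  note u = u4_def u5_def u6_def u7_def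
  have clear_halves: "x * (y / 2) = x * y / 2" "x / 2 + y / 2 = (x + y) / 2" "(x / 2 = 0) = (x = 0)"
    "x / 2 + 0 = x / 2" "x * 0 = 0" "0 + x = x" for x y :: real
    by simp_all
  have eq2: "2 * a 1 6 7 ^ 3 * b_poly a 2 3 + u4 * b_poly a 2 4 + u5 * b_poly a 2 5
      + u6 * b_poly a 2 6 + u7 * b_poly a 2 7 = 0"
    unfolding closed u clear_halves by Groebner_Basis.algebra
  have eq3: "2 * a 1 6 7 ^ 3 * b_poly a 3 3 + u4 * b_poly a 3 4 + u5 * b_poly a 3 5
      + u6 * b_poly a 3 6 + u7 * b_poly a 3 7 = 0"
    unfolding closed u clear_halves by Groebner_Basis.algebra
  have eq4: "2 * a 1 6 7 ^ 3 * b_poly a 3 4 + u4 * b_poly a 4 4 + u5 * b_poly a 4 5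
      + u6 * b_poly a 4 6 + u7 * b_poly a 4 7 = 0"
    unfolding closed u clear_halves by Groebner_Basis.algebra
  have eq5: "2 * a 1 6 7 ^ 3 * b_poly a 3 5 + u4 * b_poly a 4 5 + u5 * b_poly a 5 5
      + u6 * b_poly a 5 6 + u7 * b_poly a 5 7 = 0"
    unfolding closed u clear_halves by Groebner_Basis.algebra
  have eq6: "2 * a 1 6 7 ^ 3 * b_poly a 3 6 + u4 * b_poly a 4 6 + u5 * b_poly a 5 6
      + u6 * b_poly a 6 6 + u7 * b_poly a 6 7 = 0"
    unfolding closed u clear_halves by Groebner_Basis.algebra
  have eq7: "2 * a 1 6 7 ^ 3 * b_poly a 3 7 + u4 * b_poly a 4 7 + u5 * b_poly a 5 7
      + u6 * b_poly a 6 7 + u7 * b_poly a 7 7 = 0"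
    unfolding closed u clear_halves by Groebner_Basis.algebra
  show thesis by (rule that) (fact eq2 eq3 eq4 eq5 eq6 eq7)+
qed

section \<open>The seven-dimensional Lie algebra\<close>

lemma sum_7: "(\<Sum>i=1..7. f i) = f 1 + f 2 + f 3 + f 4 + f 5 + f 6 + f (7::nat)"
  for f :: "nat \<Rightarrow> 'b::comm_monoid_add"
  by (simp add: eval_nat_numeral)

lemma form_nth:
  assumes "is_form 3 \<rho>"
  shows "linear (\<lambda>x. \<rho> ((!) [x, y, z]))"
    and "\<rho> ((!) [y, x, z]) = - \<rho> ((!) [x, y, z])"
    and "\<rho> ((!) [x, z, y]) = - \<rho> ((!) [x, y, z])"
proof -
  have upd: "((!) xs)(i := a) = (!) (xs[i := a])" if "i < length xs" for xs :: "'a list" and i a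
    using that by (auto simp: fun_eq_iff nth_list_update)
  show "linear (\<lambda>x. \<rho> ((!) [x, y, z]))"
    using form_linear[OF assms, of 0 "(!) [x, y, z]"] by (simp add: upd)
  show "\<rho> ((!) [y, x, z]) = - \<rho> ((!) [x, y, z])"
    using form_swap[OF assms, of 0 1 "(!) [x, y, z]"] by (simp add: upd)
  show "\<rho> ((!) [x, z, y]) = - \<rho> ((!) [x, y, z])"
    using form_swap[OF assms, of 1 2 "(!) [x, y, z]"] by (simp add: upd)
qed

lemma ce_d_3:
  assumes "is_form 3 \<rho>"
  shows "ce_d br 3 \<rho> v =
    - \<rho> ((!) [br (v 0) (v 1), v 2, v 3]) + \<rho> ((!) [br (v 0) (v 2), v 1, v 3])
    - \<rho> ((!) [br (v 0) (v 3), v 1, v 2]) - \<rho> ((!) [br (v 1) (v 2), v 0, v 3])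
    + \<rho> ((!) [br (v 1) (v 3), v 0, v 2]) - \<rho> ((!) [br (v 2) (v 3), v 0, v 1])"
proof -
  have *: "\<rho> (case_nat x f) = \<rho> ((!) [x, f 0, f 1])" for x f
    by (rule form_cong[OF assms]) (auto simp: numeral_eq_Suc less_Suc_eq)
  show ?thesis
    unfolding ce_d_def * by (simp add: eval_nat_numeral insert_index_def lessThan_Suc atMost_Suc)
qed

lemma (in frame) pseudo_metric_g_form:
  fixes \<phi> :: "'v form"
  assumes "n = 7" "is_form 3 \<phi>" "\<forall>x. (\<forall>y v. b_form \<phi> x y v = 0) \<longrightarrow> x = 0"
  shows "pseudo_metric (g_form \<phi>)"
proof -
  obtain c where c: "c \<noteq> 0"
    and g: "\<And>x y. g_form \<phi> x y = b_form \<phi> x y ((!) [E 1, E 2, E 3, E 4, E 5, E 6, E 7]) / c"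
    using g_form_eq[OF assms] by auto
  let ?v = "(!) [E 1, E 2, E 3, E 4, E 5, E 6, E 7]"
  have lin: "linear (\<lambda>x. b_form \<phi> x y ?v)" "linear (\<lambda>y. b_form \<phi> x y ?v)" for x y
    using bilinear_b_form[OF assms(2), of ?v] unfolding bilinear_def by blast+
  have "bilinear (g_form \<phi>)"
    unfolding bilinear_def g using lin by (auto simp: linear_iff add_divide_distrib)
  moreover have "g_form \<phi> x y = g_form \<phi> y x" for x y
    unfolding g by (simp only: b_form_sym[OF assms(2), of x y])
  moreover have "x = 0" if x: "\<forall>y. g_form \<phi> x y = 0" for x
  proof (rule assms(3)[rule_format])
    fix y v
    have "b_form \<phi> x y ?v = 0" using x c by (simp add: g)
    then have "b_form \<phi> x y (\<lambda>i. E (Suc i)) = 0"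
      using frame_seq[OF is_form_b_form[OF assms(2), of x y], where E = E] by simp
    then show "b_form \<phi> x y v = 0"
      using top_form[of "b_form \<phi> x y" v] is_form_b_form[OF assms(2)] assms(1) by simp
  qed
  ultimately show ?thesis unfolding pseudo_metric_def by blast
qed

text \<open>The Lie algebra of the theorem, with \<open>de\<^sup>k(x, y) = - e\<^sup>k([x, y])\<close> unfolded to the coordinates of a bracket.\<close>

locale nilpotent_7 = frame 7 e E for e :: "nat \<Rightarrow> 'v::real_vector \<Rightarrow> real" and E +
  fixes br :: "'v \<Rightarrow> 'v \<Rightarrow> 'v"
  assumes lie: "lie_algebra br"
    and d_1: "e 1 (br x y) = 0"
    and d_2: "e 2 (br x y) = 0"
    and d_3: "e 3 (br x y) = - (e 1 x * e 2 y - e 1 y * e 2 x)"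
    and d_4: "e 4 (br x y) = - (e 1 x * e 3 y - e 1 y * e 3 x)"
    and d_5: "e 5 (br x y) = - (e 1 x * e 4 y - e 1 y * e 4 x)"
    and d_6: "e 6 (br x y) = - (e 1 x * e 5 y - e 1 y * e 5 x + (e 2 x * e 3 y - e 2 y * e 3 x))"
    and d_7: "e 7 (br x y) = - (e 1 x * e 6 y - e 1 y * e 6 x + (e 2 x * e 3 y - e 2 y * e 3 x)
      + (e 2 x * e 4 y - e 2 y * e 4 x))"
begin

lemmas d_simps = d_1 d_2 d_3 d_4 d_5 d_6 d_7

lemma coord_E':
  "i \<in> {1, 2, 3, 4, 5, 6, 7} \<Longrightarrow> j \<in> {1, 2, 3, 4, 5, 6, 7} \<Longrightarrow> e i (E j) = (if i = j then 1 else 0)"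
  by (rule coord_E) auto

lemma br_expand: "br x y =
    (- (e 1 x * e 2 y - e 1 y * e 2 x)) *\<^sub>R E 3 + (- (e 1 x * e 3 y - e 1 y * e 3 x)) *\<^sub>R E 4
    + (- (e 1 x * e 4 y - e 1 y * e 4 x)) *\<^sub>R E 5
    + (- (e 1 x * e 5 y - e 1 y * e 5 x + (e 2 x * e 3 y - e 2 y * e 3 x))) *\<^sub>R E 6
    + (- (e 1 x * e 6 y - e 1 y * e 6 x + (e 2 x * e 3 y - e 2 y * e 3 x)
      + (e 2 x * e 4 y - e 2 y * e 4 x))) *\<^sub>R E 7"
  using expand[of "br x y"] unfolding sum_7 d_simps by simp

lemma unimodular: "tr (br x) = 0"
  unfolding tr_def sum_7 d_simps by (simp add: coord_E')

lemma closed_coeffs_of_closed: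
  assumes rho: "is_form 3 \<rho>" and closed: "\<forall>v. ce_d br 3 \<rho> v = 0"
  shows "closed_coeffs (\<lambda>i j k. \<rho> ((!) [E i, E j, E k]))"
    and "alternating (\<lambda>i j k. \<rho> ((!) [E i, E j, E k]))"
proof -
  define a where "a i j k = \<rho> ((!) [E i, E j, E k])" for i j k
  show alt': "alternating (\<lambda>i j k. \<rho> ((!) [E i, E j, E k]))"
    unfolding alternating_def by (intro allI conjI form_nth(2,3)[OF rho])
  then have alt: "alternating a" by (simp add: a_def[abs_def])
  have br_a: "\<rho> ((!) [br (E i) (E j), E k, E l]) =
      - (e 1 (E i) * e 2 (E j) - e 1 (E j) * e 2 (E i)) * a 3 k l
      - (e 1 (E i) * e 3 (E j) - e 1 (E j) * e 3 (E i)) * a 4 k l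
      - (e 1 (E i) * e 4 (E j) - e 1 (E j) * e 4 (E i)) * a 5 k l
      - (e 1 (E i) * e 5 (E j) - e 1 (E j) * e 5 (E i) + (e 2 (E i) * e 3 (E j) - e 2 (E j) * e 3 (E i))) * a 6 k l
      - (e 1 (E i) * e 6 (E j) - e 1 (E j) * e 6 (E i) + (e 2 (E i) * e 3 (E j) - e 2 (E j) * e 3 (E i))
        + (e 2 (E i) * e 4 (E j) - e 2 (E j) * e 4 (E i))) * a 7 k l" for i j k l
    unfolding br_expand[of "E i" "E j"] linear_add[OF form_nth(1)[OF rho]]
      linear_scale[OF form_nth(1)[OF rho]] real_scaleR_def a_def by Groebner_Basis.algebra
  have "- \<rho> ((!) [br (E i) (E j), E k, E l]) + \<rho> ((!) [br (E i) (E k), E j, E l])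
      - \<rho> ((!) [br (E i) (E l), E j, E k]) - \<rho> ((!) [br (E j) (E k), E i, E l])
      + \<rho> ((!) [br (E j) (E l), E i, E k]) - \<rho> ((!) [br (E k) (E l), E i, E j]) = 0" for i j k l
    using closed[rule_format, of "(!) [E i, E j, E k, E l]"] unfolding ce_d_3[OF rho] by simp
  note C = this[unfolded br_a]
  note reduce = coord_E' alternating_sort[OF alt]
  \<comment> \<open>The coefficients of \<open>d\<rho>\<close> that are not identically zero.\<close>
  have c1234: "- (a 1 3 7) + a 1 4 6 + a 1 4 7 + a 2 3 5 = 0"
    using C[of 1 2 3 4] by (simp add: reduce)
  have c1235: "a 1 5 6 + a 1 5 7 + a 2 3 6 + a 2 4 5 = 0"
    using C[of 1 2 3 5] by (simp add: reduce)
  have c1236: "a 1 6 7 + a 2 3 7 + a 2 4 6 = 0"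
    using C[of 1 2 3 6] by (simp add: reduce)
  have c1237: "- (a 1 6 7) + a 2 4 7 = 0"
    using C[of 1 2 3 7] by (simp add: reduce)
  have c1245: "a 1 5 7 + a 2 4 6 + a 3 4 5 = 0"
    using C[of 1 2 4 5] by (simp add: reduce)
  have c1246: "a 1 6 7 + a 2 4 7 + a 2 5 6 + a 3 4 6 = 0"
    using C[of 1 2 4 6] by (simp add: reduce)
  have c1247: "a 2 5 7 + a 3 4 7 = 0"
    using C[of 1 2 4 7] by (simp add: reduce)
  have c1256: "a 2 5 7 + a 3 5 6 = 0"
    using C[of 1 2 5 6] by (simp add: reduce)
  have c1257: "a 2 6 7 + a 3 5 7 = 0"
    using C[of 1 2 5 7] by (simp add: reduce)
  have c1267: "a 3 6 7 = 0"
    using C[of 1 2 6 7] by (simp add: reduce)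
  have c1345: "a 3 4 6 = 0"
    using C[of 1 3 4 5] by (simp add: reduce)
  have c1346: "a 3 4 7 + a 3 5 6 = 0"
    using C[of 1 3 4 6] by (simp add: reduce)
  have c1347: "a 3 5 7 = 0"
    using C[of 1 3 4 7] by (simp add: reduce)
  have c1356: "a 3 5 7 + a 4 5 6 = 0"
    using C[of 1 3 5 6] by (simp add: reduce)
  have c1357: "a 3 6 7 + a 4 5 7 = 0"
    using C[of 1 3 5 7] by (simp add: reduce)
  have c1367: "a 4 6 7 = 0"
    using C[of 1 3 6 7] by (simp add: reduce)
  have c1456: "a 4 5 7 = 0"
    using C[of 1 4 5 6] by (simp add: reduce)
  have c1457: "a 4 6 7 = 0"
    using C[of 1 4 5 7] by (simp add: reduce)
  have c1467: "a 5 6 7 = 0"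
    using C[of 1 4 6 7] by (simp add: reduce)
  have c2345: "- (a 3 5 7) + a 4 5 6 + a 4 5 7 = 0"
    using C[of 2 3 4 5] by (simp add: reduce)
  have c2346: "- (a 3 6 7) + a 4 6 7 = 0"
    using C[of 2 3 4 6] by (simp add: reduce)
  have c2347: "- (a 4 6 7) = 0"
    using C[of 2 3 4 7] by (simp add: reduce)
  have c2356: "a 5 6 7 = 0"
    using C[of 2 3 5 6] by (simp add: reduce)
  have c2357: "- (a 5 6 7) = 0"
    using C[of 2 3 5 7] by (simp add: reduce)
  have c2456: "a 5 6 7 = 0"
    using C[of 2 4 5 6] by (simp add: reduce)
  show "closed_coeffs (\<lambda>i j k. \<rho> ((!) [E i, E j, E k]))"
    unfolding a_def[symmetric] closed_coeffs_def
    using c1234 c1235 c1236 c1237 c1245 c1246 c1247 c1256 c1257 c1267 c1345 c1346 c1347 c1356 c1357 c1367 c1456 c1457 c1467 c2345 c2346 c2347 c2356 c2357 c2456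
    by (intro conjI; linarith)
qed

end

section \<open>Einstein constants of closed structures\<close>

context nilpotent_7 begin

text \<open>The vector \<open>E 7\<close> is central, and \<open>g(E 7, _)\<close> has differential \<open>e\<^sup>1 \<and> \<eta>\<close> with \<open>\<eta> = b\<^sub>3 e\<^sup>2 + b\<^sub>4 e\<^sup>3\<close>. Let
\<open>p\<close> and \<open>r\<close> be the vectors dual to \<open>e\<^sup>1\<close> and \<open>\<eta>\<close>. If \<open>\<eta> = 0\<close>, then the Ricci curvature in the direction
of \<open>E 7\<close> vanishes, and so does the Einstein constant. Otherwise the Einstein equation on the isotropic
vector \<open>E 7\<close> reads \<open>g(p, p) g(r, r) = g(p, r)\<^sup>2\<close>. But \<open>p\<close> is a multiple of the cross product of \<open>E 6\<close> and
\<open>E 7\<close>, so that \<open>g(p, p) = e\<^sup>1(p) = 0\<close> while \<open>g(p, r) = \<eta>(p) = b\<^sub>4 e\<^sup>3(p) \<noteq> 0\<close>.\<close>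

theorem closed_g2star_einstein_const_0:
  assumes closed: "closed_g2star br \<rho>" and einstein: "einstein_const br (g_form \<rho>) l"
  shows "l = 0"
proof -
  let ?g = "g_form \<rho>"
  have rho: "is_form 3 \<rho>" and d: "\<forall>v. ce_d br 3 \<rho> v = 0"
    and nd: "\<forall>x. (\<forall>y v. b_form \<rho> x y v = 0) \<longrightarrow> x = 0"
    using closed unfolding closed_g2star_def g2star_def by auto
  obtain c where c: "c \<noteq> 0"
    and g: "\<And>x y. ?g x y = b_form \<rho> x y ((!) [E 1, E 2, E 3, E 4, E 5, E 6, E 7]) / c"
    using g_form_eq[OF refl rho nd] by auto
  have pm: "pseudo_metric ?g" by (rule pseudo_metric_g_form[OF refl rho nd])
  interpret M: metric_lie_algebra 7 e E br ?g
    by unfold_locales (rule lie, rule pm)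
  define a where "a = (\<lambda>i j k. \<rho> ((!) [E i, E j, E k]))"
  have cl: "closed_coeffs a" and alt: "alternating a"
    unfolding a_def by (rule closed_coeffs_of_closed[OF rho d])+
  note table = b_poly_closed[OF alt cl]
  have gE: "?g (E i) (E j) = b_poly a i j / c" for i j
    unfolding g b_form_frame[OF rho] a_def ..
  have gE': "?g (E j) (E i) = b_poly a i j / c" for i j
    using gE M.g_sym by simp
  define b3 b4 where "b3 = b_poly a 3 7 / c" and "b4 = b_poly a 4 7 / c"
  have dc: "?g (E 7) (br x y) =
      - (e 1 x * (b3 * e 2 y + b4 * e 3 y) - e 1 y * (b3 * e 2 x + b4 * e 3 x))" for x y
  proof -
    have "?g (E 7) (E 5) = 0" "?g (E 7) (E 6) = 0" "?g (E 7) (E 7) = 0"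
      "?g (E 7) (E 3) = b3" "?g (E 7) (E 4) = b4"
      unfolding gE' table by (simp_all add: b3_def b4_def table)
    then show ?thesis
      unfolding linear_expand[OF M.linear_g(1)[of "E 7"], of "br x y"] sum_7 d_simps
      by (simp add: algebra_simps)
  qed
  obtain p where p: "\<And>x. ?g p x = e 1 x"
    using M.riesz[OF linear_coord[of 1]] by auto
  have "linear (\<lambda>x. b3 * e 2 x + b4 * e 3 x)"
    using linear_coord[of 2] linear_coord[of 3] by (simp add: linear_iff algebra_simps)
  then obtain r where r: "\<And>x. ?g r x = b3 * e 2 x + b4 * e 3 x"
    using M.riesz by meson
  have central: "br (E 7) x = 0" for x
    unfolding br_expand by (simp add: coord_E')
  have ricci: "l * ?g (E 7) y = - ?g (br p r) y / 2" for y
    using M.ricci_central[OF unimodular central, of p r y] dc einstein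
    by (simp add: einstein_const_def p r)
  show "l = 0"
  proof (cases "a 3 4 5 * a 1 6 7 = 0")
    case True
    then have "b3 = 0" "b4 = 0" unfolding b3_def b4_def table by auto
    then have "r = 0" by (intro M.g_eqI) (simp add: r M.g_simps)
    then have flat: "l * ?g (E 7) y = 0" for y by (simp add: ricci M.br_simps M.g_simps)
    have "E 7 \<noteq> 0" using coord_E'[of 7 7] linear_0[OF linear_coord[of 7]] by auto
    then obtain y where "?g (E 7) y \<noteq> 0" using M.g_nondeg[of "E 7"] by blast
    then show ?thesis using flat[of y] by simp
  next
    case False
    then have b4: "b4 \<noteq> 0" unfolding b4_def table using c by simp
    obtain u4 u5 u6 u7 where ker:
      "2 * a 1 6 7 ^ 3 * b_poly a 2 3 + u4 * b_poly a 2 4 + u5 * b_poly a 2 5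
        + u6 * b_poly a 2 6 + u7 * b_poly a 2 7 = 0"
      "2 * a 1 6 7 ^ 3 * b_poly a 3 3 + u4 * b_poly a 3 4 + u5 * b_poly a 3 5
        + u6 * b_poly a 3 6 + u7 * b_poly a 3 7 = 0"
      "2 * a 1 6 7 ^ 3 * b_poly a 3 4 + u4 * b_poly a 4 4 + u5 * b_poly a 4 5
        + u6 * b_poly a 4 6 + u7 * b_poly a 4 7 = 0"
      "2 * a 1 6 7 ^ 3 * b_poly a 3 5 + u4 * b_poly a 4 5 + u5 * b_poly a 5 5
        + u6 * b_poly a 5 6 + u7 * b_poly a 5 7 = 0"
      "2 * a 1 6 7 ^ 3 * b_poly a 3 6 + u4 * b_poly a 4 6 + u5 * b_poly a 5 6
        + u6 * b_poly a 6 6 + u7 * b_poly a 6 7 = 0"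
      "2 * a 1 6 7 ^ 3 * b_poly a 3 7 + u4 * b_poly a 4 7 + u5 * b_poly a 5 7
        + u6 * b_poly a 6 7 + u7 * b_poly a 7 7 = 0"
      using b_poly_kernel[OF alt cl] by blast
    define u where "u = (2 * a 1 6 7 ^ 3) *\<^sub>R E 3 + u4 *\<^sub>R E 4 + u5 *\<^sub>R E 5 + u6 *\<^sub>R E 6 + u7 *\<^sub>R E 7"
    have gu: "?g u (E j) = (2 * a 1 6 7 ^ 3 * b_poly a 3 j + u4 * b_poly a 4 j + u5 * b_poly a 5 j
        + u6 * b_poly a 6 j + u7 * b_poly a 7 j) / c" for j
      unfolding u_def by (simp add: M.g_simps gE add_divide_distrib)
    have sym: "b_poly a j i = b_poly a i j" for i j
      using gE[of j i] gE'[of j i] c by simp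
    define k where "k = ?g u (E 1)"
    have guk: "?g u x = k * e 1 x" for x
    proof -
      have "?g u (E 2) = 0" "?g u (E 3) = 0" "?g u (E 4) = 0" "?g u (E 5) = 0" "?g u (E 6) = 0" "?g u (E 7) = 0"
        unfolding gu using ker
        by (simp_all only: sym[of 3 2] sym[of 4 2] sym[of 5 2] sym[of 6 2] sym[of 7 2] sym[of 4 3] sym[of 5 3]
            sym[of 6 3] sym[of 7 3] sym[of 5 4] sym[of 6 4] sym[of 7 4] sym[of 6 5] sym[of 7 5] sym[of 7 6])
      then show ?thesis
        unfolding linear_expand[OF M.linear_g(1)[of u], of x] sum_7 by (simp add: k_def)
    qed
    have up: "u = k *\<^sub>R p" by (rule M.g_eqI) (simp add: guk p M.g_simps)
    have eu: "e i u = (2 * a 1 6 7 ^ 3) * e i (E 3) + u4 * e i (E 4) + u5 * e i (E 5) + u6 * e i (E 6)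
        + u7 * e i (E 7)" if "i \<in> {1..7}" for i
      using linear_coord[OF that] by (simp add: u_def linear_iff)
    have "e 1 u = 0" "e 2 u = 0" "e 3 u \<noteq> 0"
      using eu[of 1] eu[of 2] eu[of 3] False by (simp_all add: coord_E')
    moreover have uk: "e i u = k * e i p" if "i \<in> {1..7}" for i
      unfolding up using linear_coord[OF that] by (simp add: linear_iff)
    ultimately have ep: "e 1 p = 0" "e 2 p = 0" "e 3 p \<noteq> 0"
      using uk[of 1] uk[of 2] uk[of 3] by auto
    have "?g (E 7) (E 7) = 0" unfolding gE table by simp
    then have "?g (E 7) (br p r) = 0"
      using ricci[of "E 7"] M.g_sym[of "E 7" "br p r"] by simp
    then have "?g p r * ?g r p = 0"
      unfolding dc p[symmetric] r[symmetric] using ep(1) by (simp add: p)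
    then have "?g r p = 0" using M.g_sym[of p r] by simp
    then show ?thesis using ep b4 by (simp add: r)
  qed
qed

end

section \<open>A closed structure\<close>

definition e3 :: "(nat \<Rightarrow> 'v \<Rightarrow> real) \<Rightarrow> nat \<Rightarrow> nat \<Rightarrow> nat \<Rightarrow> 'v form" where
  "e3 e i j k = wedge 1 2 (one_form (e i)) (e2 e j k)"

lemma is_form_one_form: "linear \<alpha> \<Longrightarrow> is_form 1 (one_form \<alpha>)"
  by (auto simp: is_form_def one_form_def)

lemma is_form_e3:
  assumes "linear (e i)" "linear (e j)" "linear (e k)"
  shows "is_form 3 (e3 e i j k)"
proof -
  have "is_form (1 + 1) (e2 e j k)"
    unfolding e2_def by (intro is_form_wedge is_form_one_form assms)
  then have "is_form 2 (e2 e j k)" by (simp only: one_add_one)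
  then have "is_form (1 + 2) (e3 e i j k)"
    unfolding e3_def by (intro is_form_wedge is_form_one_form assms)
  then show ?thesis by (simp add: eval_nat_numeral)
qed

lemma e3_nth:
  assumes "linear (e i)" "linear (e j)" "linear (e k)"
  shows "e3 e i j k ((!) [x, y, z]) = e i x * (e j y * e k z - e j z * e k y)
    - e i y * (e j x * e k z - e j z * e k x) + e i z * (e j x * e k y - e j y * e k x)"
proof -
  have "is_form (1 + 1) (e2 e j k)"
    unfolding e2_def by (intro is_form_wedge is_form_one_form assms)
  then have 2: "is_form 2 (e2 e j k)" by (simp only: one_add_one)
  have "wedge 1 2 \<alpha> \<beta> ((!) [x, y, z]) = \<alpha> ((!) [x]) * \<beta> ((!) [y, z]) - \<alpha> ((!) [y]) * \<beta> ((!) [x, z])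
      + \<alpha> ((!) [z]) * \<beta> ((!) [x, y])" if "is_form 1 \<alpha>" "is_form 2 \<beta>" for \<alpha> \<beta> :: "'a form"
    using that by (simp add: numeral_eq_Suc wedge_eval)
  from this[OF is_form_one_form[OF assms(1)] 2] show ?thesis
    unfolding e3_def by (simp add: e2_eq one_form_def)
qed

context nilpotent_7 begin

text \<open>The member of the 18-parameter family of closed forms with \<open>a 1 2 3 = a 1 6 7 = 1\<close> and all other free
parameters zero. The Gram matrix of \<open>b\<^sub>\<phi>\<close> is then so sparse that nondegeneracy is read off; \<open>E 2\<close> and
\<open>E 4 + E 7\<close> have values of opposite signs, which settles indefiniteness whatever the sign of the
volume.\<close>

theorem ex_closed_g2star: "\<exists>\<phi>. closed_g2star br \<phi>"
proof -
  define \<phi> where "\<phi> = (\<lambda>v. e3 e 1 2 3 v + e3 e 1 6 7 v - e3 e 2 4 6 v + e3 e 2 4 7 v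
    - 2 * e3 e 2 5 6 v + e3 e 3 4 5 v)"
  have lin: "linear (e 1)" "linear (e 2)" "linear (e 3)" "linear (e 4)" "linear (e 5)" "linear (e 6)"
    "linear (e 7)"
    by (auto intro: linear_coord)
  have "is_form 3 (\<lambda>v. e3 e 1 2 3 v - (- 1) * e3 e 1 6 7 v - 1 * e3 e 2 4 6 v - (- 1) * e3 e 2 4 7 v
      - 2 * e3 e 2 5 6 v - (- 1) * e3 e 3 4 5 v)"
    by (intro is_form_diff is_form_e3 lin)
  then have form: "is_form 3 \<phi>" by (simp add: \<phi>_def)
  have closed: "ce_d br 3 \<phi> v = 0" for v
    unfolding ce_d_3[OF form] by (simp only: \<phi>_def e3_nth lin d_simps) Groebner_Basis.algebra
  define a where "a = (\<lambda>i j k. \<phi> ((!) [E i, E j, E k]))"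
  have alt: "alternating a"
    unfolding a_def by (rule closed_coeffs_of_closed[OF form]) (simp add: closed)
  have a:
    "a 1 2 3 = 1" "a 1 2 4 = 0" "a 1 2 5 = 0" "a 1 2 6 = 0" "a 1 2 7 = 0" "a 1 3 4 = 0"
    "a 1 3 5 = 0" "a 1 3 6 = 0" "a 1 3 7 = 0" "a 1 4 5 = 0" "a 1 4 6 = 0" "a 1 4 7 = 0"
    "a 1 5 6 = 0" "a 1 5 7 = 0" "a 1 6 7 = 1" "a 2 3 4 = 0" "a 2 3 5 = 0" "a 2 3 6 = 0"
    "a 2 3 7 = 0" "a 2 4 5 = 0" "a 2 4 6 = - 1" "a 2 4 7 = 1" "a 2 5 6 = - 2" "a 2 5 7 = 0"
    "a 2 6 7 = 0" "a 3 4 5 = 1" "a 3 4 6 = 0" "a 3 4 7 = 0" "a 3 5 6 = 0" "a 3 5 7 = 0"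
    "a 3 6 7 = 0" "a 4 5 6 = 0" "a 4 5 7 = 0" "a 4 6 7 = 0" "a 5 6 7 = 0"
    by (simp_all add: a_def \<phi>_def e3_nth lin coord_E' del: One_nat_def)
  have b:
    "b_poly a 1 1 = 0" "b_poly a 1 2 = 0" "b_poly a 1 3 = 1 / 2" "b_poly a 1 4 = 0"
    "b_poly a 1 5 = 0" "b_poly a 1 6 = 0" "b_poly a 1 7 = 0" "b_poly a 2 1 = 0"
    "b_poly a 2 2 = - 2" "b_poly a 2 3 = 0" "b_poly a 2 4 = 0" "b_poly a 2 5 = 0"
    "b_poly a 2 6 = 0" "b_poly a 2 7 = 0" "b_poly a 3 1 = 1 / 2" "b_poly a 3 2 = 0"
    "b_poly a 3 3 = 0" "b_poly a 3 4 = 0" "b_poly a 3 5 = 0" "b_poly a 3 6 = 0"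
    "b_poly a 3 7 = 0" "b_poly a 4 1 = 0" "b_poly a 4 2 = 0" "b_poly a 4 3 = 0"
    "b_poly a 4 4 = 0" "b_poly a 4 5 = 0" "b_poly a 4 6 = - 1 / 2" "b_poly a 4 7 = 1 / 2"
    "b_poly a 5 1 = 0" "b_poly a 5 2 = 0" "b_poly a 5 3 = 0" "b_poly a 5 4 = 0"
    "b_poly a 5 5 = 0" "b_poly a 5 6 = - 1" "b_poly a 5 7 = 0" "b_poly a 6 1 = 0"
    "b_poly a 6 2 = 0" "b_poly a 6 3 = 0" "b_poly a 6 4 = - 1 / 2" "b_poly a 6 5 = - 1"
    "b_poly a 6 6 = 0" "b_poly a 6 7 = 0" "b_poly a 7 1 = 0" "b_poly a 7 2 = 0"
    "b_poly a 7 3 = 0" "b_poly a 7 4 = 1 / 2" "b_poly a 7 5 = 0" "b_poly a 7 6 = 0"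
    "b_poly a 7 7 = 0"
    by (simp_all only: b_poly_def Let_def alternating_sort[OF alt] index_less drop_zero a) simp_all
  let ?v = "(!) [E 1, E 2, E 3, E 4, E 5, E 6, E 7]"
  have B: "b_form \<phi> (E i) (E j) ?v = b_poly a i j" for i j
    unfolding b_form_frame[OF form] a_def ..
  have linB: "linear (\<lambda>x. b_form \<phi> x y ?v)" "linear (\<lambda>y. b_form \<phi> x y ?v)" for x y
    using bilinear_b_form[OF form, of ?v] unfolding bilinear_def by blast+
  have nd: "\<forall>x. (\<forall>y v. b_form \<phi> x y v = 0) \<longrightarrow> x = 0"
  proof (intro allI impI)
    fix x assume "\<forall>y v. b_form \<phi> x y v = 0"
    then have "b_form \<phi> x (E j) ?v = 0" for j by blast
    then have z: "(\<Sum>i=1..7. e i x * b_form \<phi> (E i) (E j) ?v) = 0" for j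
      using linear_expand[OF linB(1)[of "E j"], of x] by simp
    have "e 1 x = 0" "e 2 x = 0" "e 3 x = 0" "e 4 x = 0" "e 5 x = 0" "e 6 x = 0" "e 7 x = 0"
      using z[of 1] z[of 2] z[of 3] z[of 4] z[of 5] z[of 6] z[of 7]
      unfolding sum_7 B b by simp_all
    then show "x = 0" using expand[of x] unfolding sum_7 by simp
  qed
  obtain c where c: "c \<noteq> 0" and g: "\<And>x y. g_form \<phi> x y = b_form \<phi> x y ?v / c"
    using g_form_eq[OF refl form nd] by auto
  have "b_form \<phi> (E 2) (E 2) ?v = - 2" unfolding B b ..
  moreover have "b_form \<phi> (E 4 + E 7) (E 4 + E 7) ?v = 1"
    unfolding linear_add[OF linB(1)] linear_add[OF linB(2)] B b by simp
  ultimately have g2: "g_form \<phi> (E 2) (E 2) = - 2 / c" "g_form \<phi> (E 4 + E 7) (E 4 + E 7) = 1 / c"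
    by (simp_all add: g)
  have "(\<exists>x. g_form \<phi> x x > 0) \<and> (\<exists>x. g_form \<phi> x x < 0)"
  proof (cases "c > 0")
    case True
    then have "g_form \<phi> (E 2) (E 2) < 0" "g_form \<phi> (E 4 + E 7) (E 4 + E 7) > 0" unfolding g2 by auto
    then show ?thesis by blast
  next
    case False
    with c have "c < 0" by simp
    then have "g_form \<phi> (E 2) (E 2) > 0" "g_form \<phi> (E 4 + E 7) (E 4 + E 7) < 0"
      unfolding g2 by (auto simp: divide_simps)
    then show ?thesis by blast
  qed
  then show ?thesis
    using form nd closed unfolding closed_g2star_def g2star_def by blast
qed

end

section \<open>An orthogonal frame with an Einstein metric\<close>

lemma (in frame) diagonal_right:
  assumes "bilinear g" "\<And>i j. i \<in> {1..n} \<Longrightarrow> j \<in> {1..n} \<Longrightarrow> g (E i) (E j) = (if i = j then \<epsilon> i else 0)"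
    and j: "j \<in> {1..n}"
  shows "g x (E j) = e j x * \<epsilon> j"
proof -
  have lin: "linear (\<lambda>x. g x (E j))" using assms(1) by (simp add: bilinear_def)
  have "g x (E j) = (\<Sum>i=1..n. e i x * (if i = j then \<epsilon> i else 0))"
    unfolding linear_expand[OF lin, of x] real_scaleR_def
  proof (rule sum.cong[OF refl])
    fix i assume "i \<in> {1..n}"
    from assms(2)[OF this j] show "e i x * g (E i) (E j) = e i x * (if i = j then \<epsilon> i else 0)"
      by (rule arg_cong)
  qed
  also have "\<dots> = e j x * \<epsilon> j"
    using j by (simp add: if_distrib[of "\<lambda>t. _ * t"] cong: if_cong)
  finally show ?thesis .
qed

lemma (in frame) pseudo_metric_diagonal:
  assumes g: "bilinear g" "\<And>i j. i \<in> {1..n} \<Longrightarrow> j \<in> {1..n} \<Longrightarrow> g (E i) (E j) = (if i = j then \<epsilon> i else 0)"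
    and \<epsilon>: "\<And>i. i \<in> {1..n} \<Longrightarrow> \<epsilon> i \<noteq> 0"
  shows "pseudo_metric g"
proof -
  have lin: "linear (g x)" for x using g(1) by (simp add: bilinear_def)
  have exp: "g x y = (\<Sum>j=1..n. e j y * (e j x * \<epsilon> j))" for x y
    unfolding linear_expand[OF lin[of x], of y] real_scaleR_def
    by (intro sum.cong[OF refl] arg_cong[where f = "(*) _"] diagonal_right[OF g])
  have "g x y = g y x" for x y
    unfolding exp by (intro sum.cong refl) simp
  moreover have "x = 0" if x: "\<forall>y. g x y = 0" for x
  proof -
    have "e j x = 0" if j: "j \<in> {1..n}" for j
      using diagonal_right[OF g j, of x] x \<epsilon>[OF j] by simp
    then show ?thesis using expand[of x] by simp
  qed
  ultimately show ?thesis using g(1) unfolding pseudo_metric_def by blast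
qed

context metric_lie_algebra begin

text \<open>The Christoffel symbols in an orthogonal frame, from the Koszul formula.\<close>

lemma connection_diagonal:
  assumes g: "\<And>i j. i \<in> {1..n} \<Longrightarrow> j \<in> {1..n} \<Longrightarrow> g (E i) (E j) = (if i = j then \<epsilon> i else 0)"
    and \<epsilon>: "\<And>i. i \<in> {1..n} \<Longrightarrow> \<epsilon> i \<noteq> 0"
    and ijk: "i \<in> {1..n}" "j \<in> {1..n}" "k \<in> {1..n}"
  shows "e k (D (E i) (E j)) = (e k (br (E i) (E j)) * \<epsilon> k - e i (br (E j) (E k)) * \<epsilon> i
    + e j (br (E k) (E i)) * \<epsilon> j) / (2 * \<epsilon> k)"
proof -
  have right: "j \<in> {1..n} \<Longrightarrow> g x (E j) = e j x * \<epsilon> j" for j x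
    by (rule diagonal_right[OF bilinear_g g])
  have "2 * (e k (D (E i) (E j)) * \<epsilon> k) = e k (br (E i) (E j)) * \<epsilon> k - e i (br (E j) (E k)) * \<epsilon> i
    + e j (br (E k) (E i)) * \<epsilon> j"
    using koszul[of "E i" "E j" "E k"] by (simp only: right ijk)
  then show ?thesis using \<epsilon>[OF ijk(3)] by (simp add: field_simps)
qed

lemma ricci_frame:
  assumes "\<And>x. tr (br x) = 0"
  shows "ricci br g x y = - (\<Sum>i=1..n. e i (D (D (E i) x) y))"
  unfolding ricci_unimodular[OF assms] tr_def ..

lemma bilinear_ricci:
  assumes "\<And>x. tr (br x) = 0"
  shows "bilinear (ricci br g)"
proof -
  have "linear (\<lambda>y. - tr (\<lambda>z. D (D z x) y))" "linear (\<lambda>x. - tr (\<lambda>z. D (D z x) y))" for x y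
    by (simp_all add: linear_iff bilinear_radd[OF bilinear_D] bilinear_rmul[OF bilinear_D]
        bilinear_ladd[OF bilinear_D] bilinear_lmul[OF bilinear_D] tr_add tr_scale)
  then show ?thesis unfolding bilinear_def ricci_unimodular[OF assms] by blast
qed

end

context nilpotent_7 begin

text \<open>In the basis \<open>F\<close> the bracket has only eleven nonzero structure constants (up to antisymmetry), and the
Levi-Civita connection is a short table of sparse vectors. The Ricci curvature of each pair of basis
vectors is then a finite rational computation; the constant is the common ratio that it shows.\<close>

theorem diagonal_einstein_metric:
  fixes f :: "nat \<Rightarrow> 'v \<Rightarrow> real" and F :: "nat \<Rightarrow> 'v" and g :: "'v \<Rightarrow> 'v \<Rightarrow> real"
  assumes frame: "frame 7 f F"
    and e_1: "\<And>x. e 1 x = f 1 x"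
    and e_2: "\<And>x. e 2 x = f 2 x"
    and e_3: "\<And>x. e 3 x = - (26 / 51) * f 2 x + f 3 x"
    and e_4: "\<And>x. e 4 x = - (2300 / 2601) * f 2 x - (26 / 51) * f 3 x + f 4 x"
    and e_5: "\<And>x. e 5 x = - (2300 / 2601) * f 3 x + (46 / 51) * f 4 x + f 5 x"
    and e_6: "\<And>x. e 6 x = - (2300 / 2601) * f 4 x + f 6 x"
    and e_7: "\<And>x. e 7 x = - (50 / 51) * f 6 x + f 7 x"
    and bil: "bilinear g"
    and diag: "\<And>i j. i \<in> {1..7} \<Longrightarrow> j \<in> {1..7} \<Longrightarrow> g (F i) (F j) =
        (if i = j then
          [71639296000000000 / 168377826559400929,
           - (1946720000000 / 2015993900449),
           - (2116000000 / 6975757441),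
           21160000 / 24137569,
           - (115000 / 250563),
           - (600 / 289),
           1] ! (i - 1)
         else 0)"
  shows "pseudo_metric g" "einstein_const br g (48661191875666868481 / 659081523200000000000)"
proof -
  interpret f: frame 7 f F by (rule frame)
  define \<epsilon> :: "nat \<Rightarrow> real" where "\<epsilon> i =
          [71639296000000000 / 168377826559400929,
           - (1946720000000 / 2015993900449),
           - (2116000000 / 6975757441),
           21160000 / 24137569,
           - (115000 / 250563),
           - (600 / 289),
           1] ! (i - 1)" for i
  have \<epsilon>: "\<epsilon> 1 = 71639296000000000 / 168377826559400929"
    "\<epsilon> 2 = - (1946720000000 / 2015993900449)" "\<epsilon> 3 = - (2116000000 / 6975757441)"
    "\<epsilon> 4 = 21160000 / 24137569" "\<epsilon> 5 = - (115000 / 250563)" "\<epsilon> 6 = - (600 / 289)" "\<epsilon> 7 = 1"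
    by (simp_all add: \<epsilon>_def)
  have set_7: "i \<in> {1..7} \<longleftrightarrow> i = 1 \<or> i = 2 \<or> i = 3 \<or> i = 4 \<or> i = 5 \<or> i = 6 \<or> i = 7" for i :: nat
    by auto
  have nz: "\<epsilon> i \<noteq> 0" if "i \<in> {1..7}" for i
    using that unfolding set_7 by (elim disjE; hypsubst; simp add: \<epsilon> del: One_nat_def)
  note diag' = diag[folded \<epsilon>_def]
  show pm: "pseudo_metric g" by (rule f.pseudo_metric_diagonal[OF bil diag' nz])
  interpret M: metric_lie_algebra 7 f F br g
    by unfold_locales (rule lie, rule pm)
  have lin: "linear (f 1)" "linear (f 2)" "linear (f 3)" "linear (f 4)" "linear (f 5)" "linear (f 6)"
    "linear (f 7)" by (auto intro: f.linear_coord)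
  have br_1: "f 1 (br x y) = 0" for x y
    using d_1[of x y] by (simp only: e_1)
  have br_2: "f 2 (br x y) = 0" for x y
    using d_2[of x y] by (simp only: e_2)
  have br_3: "f 3 (br x y) = - (f 1 x * f 2 y - f 1 y * f 2 x)" for x y
    using d_3[of x y] e_3[of "br x y"] br_2[of x y] by (simp only: e_1 e_2)
  have br_4: "f 4 (br x y) = - (f 1 x * f 3 y - f 1 y * f 3 x)" for x y
    using d_4[of x y] br_2[of x y] br_3[of x y] unfolding e_1 e_2 e_3 e_4 by (simp add: field_simps)
  have br_5: "f 5 (br x y) = 24 / 17 * (f 1 x * f 3 y - f 1 y * f 3 x)
      - (f 1 x * f 4 y - f 1 y * f 4 x)" for x y
    using d_5[of x y] br_3[of x y] br_4[of x y] unfolding e_1 e_2 e_3 e_4 e_5 by (simp add: field_simps)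
  have br_6: "f 6 (br x y) = - (46 / 51) * (f 1 x * f 4 y - f 1 y * f 4 x)
      - (f 1 x * f 5 y - f 1 y * f 5 x) - (f 2 x * f 3 y - f 2 y * f 3 x)" for x y
    using d_6[of x y] br_4[of x y] unfolding e_1 e_2 e_3 e_4 e_5 e_6 by (simp add: field_simps)
  have br_7: "f 7 (br x y) = - (50 / 51) * (f 1 x * f 5 y - f 1 y * f 5 x)
      - (f 1 x * f 6 y - f 1 y * f 6 x) - 25 / 17 * (f 2 x * f 3 y - f 2 y * f 3 x)
      - (f 2 x * f 4 y - f 2 y * f 4 x)" for x y
    using d_7[of x y] br_6[of x y] unfolding e_1 e_2 e_3 e_4 e_5 e_6 e_7 by (simp add: field_simps)
  note f_br = br_1 br_2 br_3 br_4 br_5 br_6 br_7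
  have fF: "f i (F j) = (if i = j then 1 else 0)" if "1 \<le> i" "i \<le> 7" "1 \<le> j" "j \<le> 7" for i j
    using that by (intro f.coord_E) auto
  have conn: "M.D (F i) (F j) = (\<Sum>k=1..7. ((f k (br (F i) (F j)) * \<epsilon> k - f i (br (F j) (F k)) * \<epsilon> i
      + f j (br (F k) (F i)) * \<epsilon> j) / (2 * \<epsilon> k)) *\<^sub>R F k)"
    if "1 \<le> i" "i \<le> 7" "1 \<le> j" "j \<le> 7" for i j
  proof -
    have "M.D (F i) (F j) = (\<Sum>k=1..7. f k (M.D (F i) (F j)) *\<^sub>R F k)" by (rule f.expand)
    also have "\<dots> = (\<Sum>k=1..7. ((f k (br (F i) (F j)) * \<epsilon> k - f i (br (F j) (F k)) * \<epsilon> i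
      + f j (br (F k) (F i)) * \<epsilon> j) / (2 * \<epsilon> k)) *\<^sub>R F k)"
      by (intro sum.cong[OF refl] arg_cong2[where f = scaleR] refl M.connection_diagonal[OF diag' nz])
        (use that in auto)
    finally show ?thesis .
  qed
  have D:
    "M.D (F 1) (F 1) = 0" "M.D (F 1) (F 2) = (- 1 / 2) *\<^sub>R F 3"
    "M.D (F 1) (F 3) = (289 / 1840) *\<^sub>R F 2 + (- 1 / 2) *\<^sub>R F 4 + (12 / 17) *\<^sub>R F 5"
    "M.D (F 1) (F 4) = (- 289 / 200) *\<^sub>R F 3 + (- 1 / 2) *\<^sub>R F 5 + (- 23 / 51) *\<^sub>R F 6"
    "M.D (F 1) (F 5) = (- 4913 / 4600) *\<^sub>R F 3 + (- 289 / 1104) *\<^sub>R F 4 + (- 1 / 2) *\<^sub>R F 6 + (- 25 / 51) *\<^sub>R F 7"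
    "M.D (F 1) (F 6) = (- 4913 / 4600) *\<^sub>R F 4 + (2601 / 1150) *\<^sub>R F 5 + (- 1 / 2) *\<^sub>R F 7"
    "M.D (F 1) (F 7) = (- 4913 / 4600) *\<^sub>R F 5 + (- 289 / 1200) *\<^sub>R F 6"
    "M.D (F 2) (F 1) = (1 / 2) *\<^sub>R F 3" "M.D (F 2) (F 2) = 0"
    "M.D (F 2) (F 3) = (24137569 / 67712000) *\<^sub>R F 1 + (- 1 / 2) *\<^sub>R F 6 + (- 25 / 34) *\<^sub>R F 7"
    "M.D (F 2) (F 4) = (- 1 / 2) *\<^sub>R F 7" "M.D (F 2) (F 5) = 0"
    "M.D (F 2) (F 6) = (72412707 / 21160000) *\<^sub>R F 3"
    "M.D (F 2) (F 7) = (- 410338673 / 169280000) *\<^sub>R F 3 + (24137569 / 42320000) *\<^sub>R F 4"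
    "M.D (F 3) (F 1) = (289 / 1840) *\<^sub>R F 2 + (1 / 2) *\<^sub>R F 4 + (- 12 / 17) *\<^sub>R F 5"
    "M.D (F 3) (F 2) = (24137569 / 67712000) *\<^sub>R F 1 + (1 / 2) *\<^sub>R F 6 + (25 / 34) *\<^sub>R F 7"
    "M.D (F 3) (F 3) = 0" "M.D (F 3) (F 4) = (- 6975757441 / 6771200000) *\<^sub>R F 1"
    "M.D (F 3) (F 5) = (- 118587876497 / 155737600000) *\<^sub>R F 1"
    "M.D (F 3) (F 6) = (- 20927272323 / 19467200000) *\<^sub>R F 2"
    "M.D (F 3) (F 7) = (118587876497 / 155737600000) *\<^sub>R F 2"
    "M.D (F 4) (F 1) = (- 289 / 200) *\<^sub>R F 3 + (1 / 2) *\<^sub>R F 5 + (23 / 51) *\<^sub>R F 6"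
    "M.D (F 4) (F 2) = (1 / 2) *\<^sub>R F 7"
    "M.D (F 4) (F 3) = (- 6975757441 / 6771200000) *\<^sub>R F 1" "M.D (F 4) (F 4) = 0"
    "M.D (F 4) (F 5) = (2015993900449 / 3737702400000) *\<^sub>R F 1"
    "M.D (F 4) (F 6) = (34271896307633 / 15573760000000) *\<^sub>R F 1"
    "M.D (F 4) (F 7) = (2015993900449 / 3893440000000) *\<^sub>R F 2"
    "M.D (F 5) (F 1) = (- 4913 / 4600) *\<^sub>R F 3 + (- 289 / 1104) *\<^sub>R F 4 + (1 / 2) *\<^sub>R F 6 + (25 / 51) *\<^sub>R F 7"
    "M.D (F 5) (F 2) = 0" "M.D (F 5) (F 3) = (- 118587876497 / 155737600000) *\<^sub>R F 1"
    "M.D (F 5) (F 4) = (2015993900449 / 3737702400000) *\<^sub>R F 1" "M.D (F 5) (F 5) = 0"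
    "M.D (F 5) (F 6) = (1747866711689283 / 716392960000000) *\<^sub>R F 1"
    "M.D (F 5) (F 7) = (- 9904578032905937 / 8596715520000000) *\<^sub>R F 1"
    "M.D (F 6) (F 1) = (- 4913 / 4600) *\<^sub>R F 4 + (2601 / 1150) *\<^sub>R F 5 + (1 / 2) *\<^sub>R F 7"
    "M.D (F 6) (F 2) = (72412707 / 21160000) *\<^sub>R F 3"
    "M.D (F 6) (F 3) = (- 20927272323 / 19467200000) *\<^sub>R F 2"
    "M.D (F 6) (F 4) = (34271896307633 / 15573760000000) *\<^sub>R F 1"
    "M.D (F 6) (F 5) = (1747866711689283 / 716392960000000) *\<^sub>R F 1" "M.D (F 6) (F 6) = 0"
    "M.D (F 6) (F 7) = (- 168377826559400929 / 143278592000000000) *\<^sub>R F 1"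
    "M.D (F 7) (F 1) = (- 4913 / 4600) *\<^sub>R F 5 + (- 289 / 1200) *\<^sub>R F 6"
    "M.D (F 7) (F 2) = (- 410338673 / 169280000) *\<^sub>R F 3 + (24137569 / 42320000) *\<^sub>R F 4"
    "M.D (F 7) (F 3) = (118587876497 / 155737600000) *\<^sub>R F 2"
    "M.D (F 7) (F 4) = (2015993900449 / 3893440000000) *\<^sub>R F 2"
    "M.D (F 7) (F 5) = (- 9904578032905937 / 8596715520000000) *\<^sub>R F 1"
    "M.D (F 7) (F 6) = (- 168377826559400929 / 143278592000000000) *\<^sub>R F 1"
    "M.D (F 7) (F 7) = 0"
    by (simp_all add: conn[unfolded sum_7] f_br fF \<epsilon> del: One_nat_def)
  have unimod: "f.tr (br x) = 0" for x
    unfolding f.tr_def sum_7 f_br by (simp add: fF)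
  note lin_simps = lin[THEN linear_add] lin[THEN linear_scale] lin[THEN linear_0]
    lin[THEN linear_diff] lin[THEN linear_neg]
  have ricci: "ricci br g (F i) (F j) = 48661191875666868481 / 659081523200000000000 * g (F i) (F j)"
    if "i \<in> {1..7}" "j \<in> {1..7}" for i j
    using that unfolding M.ricci_frame[OF unimod] sum_7 diag'[OF that] unfolding set_7
    by (elim disjE; hypsubst; simp add: D bilinear_ladd[OF M.bilinear_D] bilinear_lmul[OF M.bilinear_D]
        bilinear_lsub[OF M.bilinear_D] bilinear_lneg[OF M.bilinear_D] bilinear_lzero[OF M.bilinear_D] lin_simps fF \<epsilon> del: One_nat_def)
  show "einstein_const br g (48661191875666868481 / 659081523200000000000)"
    unfolding einstein_const_def
  proof (intro allI)
    fix x y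
    show "ricci br g x y = 48661191875666868481 / 659081523200000000000 * g x y"
      unfolding f.bilinear_expand[OF M.bilinear_ricci[OF unimod], of x y] f.bilinear_expand[OF bil, of x y]
        sum_distrib_left
      by (intro sum.cong refl) (simp add: ricci)
  qed
qed

end

section \<open>The theorem\<close>

theorem theorem3p10:
  fixes br :: "'v::real_vector \<Rightarrow> 'v \<Rightarrow> 'v"
    and e :: "nat \<Rightarrow> 'v \<Rightarrow> real"
  assumes "dim (UNIV :: 'v set) = 7"
    and "lie_algebra br"
    and "lie_nilpotent br"
    and "is_dual_basis 7 e"
    and "\<forall>v. ce_d br 1 (one_form (e 1)) v = 0"
    and "\<forall>v. ce_d br 1 (one_form (e 2)) v = 0"
    and "\<forall>v. ce_d br 1 (one_form (e 3)) v = e2 e 1 2 v"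
    and "\<forall>v. ce_d br 1 (one_form (e 4)) v = e2 e 1 3 v"
    and "\<forall>v. ce_d br 1 (one_form (e 5)) v = e2 e 1 4 v"
    and "\<forall>v. ce_d br 1 (one_form (e 6)) v = e2 e 1 5 v + e2 e 2 3 v"
    and "\<forall>v. ce_d br 1 (one_form (e 7)) v = e2 e 1 6 v + e2 e 2 3 v + e2 e 2 4 v"
  shows "(\<exists>\<phi>. closed_g2star br \<phi>) \<and>
    (\<nexists>\<rho>. closed_g2star br \<rho> \<and> einstein br (g_form \<rho>) \<and> \<not> ricci_flat br (g_form \<rho>)) \<and>
    (\<forall>(f :: nat \<Rightarrow> 'v \<Rightarrow> real) (f_dual :: nat \<Rightarrow> 'v) (g :: 'v \<Rightarrow> 'v \<Rightarrow> real).
      is_dual_basis 7 f \<and>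
      (\<forall>x. e 1 x = f 1 x) \<and>
      (\<forall>x. e 2 x = f 2 x) \<and>
      (\<forall>x. e 3 x = - (26 / 51) * f 2 x + f 3 x) \<and>
      (\<forall>x. e 4 x = - (2300 / 2601) * f 2 x - (26 / 51) * f 3 x + f 4 x) \<and>
      (\<forall>x. e 5 x = - (2300 / 2601) * f 3 x + (46 / 51) * f 4 x + f 5 x) \<and>
      (\<forall>x. e 6 x = - (2300 / 2601) * f 4 x + f 6 x) \<and>
      (\<forall>x. e 7 x = - (50 / 51) * f 6 x + f 7 x) \<and>
      (\<forall>i\<in>{1..7}. \<forall>j\<in>{1..7}. f i (f_dual j) = (if i = j then 1 else 0)) \<and>
      bilinear g \<and>
      (\<forall>i\<in>{1..7}. \<forall>j\<in>{1..7}. g (f_dual i) (f_dual j) =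
        (if i = j then
          [71639296000000000 / 168377826559400929,
           - (1946720000000 / 2015993900449),
           - (2116000000 / 6975757441),
           21160000 / 24137569,
           - (115000 / 250563),
           - (600 / 289),
           1] ! (i - 1)
         else 0))
      \<longrightarrow> pseudo_metric g \<and> einstein br g \<and> \<not> ricci_flat br g \<and>
          (\<nexists>\<rho>. closed_g2star br \<rho> \<and> g_form \<rho> = g))"
proof -
  obtain E where E: "frame 7 e E"
    by (rule frame_of_dual_basis[OF _ assms(4)]) (simp add: assms(1), rule that)
  have d:
    "e 1 (br x y) = 0"
    "e 2 (br x y) = 0"
    "e 3 (br x y) = - (e 1 x * e 2 y - e 1 y * e 2 x)"
    "e 4 (br x y) = - (e 1 x * e 3 y - e 1 y * e 3 x)"
    "e 5 (br x y) = - (e 1 x * e 4 y - e 1 y * e 4 x)"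
    "e 6 (br x y) = - (e 1 x * e 5 y - e 1 y * e 5 x + (e 2 x * e 3 y - e 2 y * e 3 x))"
    "e 7 (br x y) = - (e 1 x * e 6 y - e 1 y * e 6 x + (e 2 x * e 3 y - e 2 y * e 3 x)
      + (e 2 x * e 4 y - e 2 y * e 4 x))" for x y
  proof -
    have v: "(!) [x, y] 0 = x" "(!) [x, y] 1 = y" by simp_all
    note d = assms(5-11)[unfolded ce_d_one_form e2_eq, rule_format, of "(!) [x, y]", unfolded v]
    show "e 1 (br x y) = 0" using d(1) by linarith
    show "e 2 (br x y) = 0" using d(2) by linarith
    show "e 3 (br x y) = - (e 1 x * e 2 y - e 1 y * e 2 x)" using d(3) by linarith
    show "e 4 (br x y) = - (e 1 x * e 3 y - e 1 y * e 3 x)" using d(4) by linarith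
    show "e 5 (br x y) = - (e 1 x * e 4 y - e 1 y * e 4 x)" using d(5) by linarith
    show "e 6 (br x y) = - (e 1 x * e 5 y - e 1 y * e 5 x + (e 2 x * e 3 y - e 2 y * e 3 x))"
      using d(6) by linarith
    show "e 7 (br x y) = - (e 1 x * e 6 y - e 1 y * e 6 x + (e 2 x * e 3 y - e 2 y * e 3 x)
      + (e 2 x * e 4 y - e 2 y * e 4 x))" using d(7) by linarith
  qed
  interpret nilpotent_7 e E br
    by (intro nilpotent_7.intro nilpotent_7_axioms.intro E assms(2) d)
  have obstruction: "ricci_flat br (g_form \<rho>)"
    if "closed_g2star br \<rho>" "einstein br (g_form \<rho>)" for \<rho>
    using that closed_g2star_einstein_const_0[OF that(1)]
    unfolding einstein_def ricci_flat_def by metis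
  have diagonal: "pseudo_metric g \<and> einstein br g \<and> \<not> ricci_flat br g"
    if f: "is_dual_basis 7 f"
      and ef: "\<forall>x. e 1 x = f 1 x" "\<forall>x. e 2 x = f 2 x"
        "\<forall>x. e 3 x = - (26 / 51) * f 2 x + f 3 x"
        "\<forall>x. e 4 x = - (2300 / 2601) * f 2 x - (26 / 51) * f 3 x + f 4 x"
        "\<forall>x. e 5 x = - (2300 / 2601) * f 3 x + (46 / 51) * f 4 x + f 5 x"
        "\<forall>x. e 6 x = - (2300 / 2601) * f 4 x + f 6 x"
        "\<forall>x. e 7 x = - (50 / 51) * f 6 x + f 7 x"
      and f_dual: "\<forall>i\<in>{1..7}. \<forall>j\<in>{1..7}. f i (f_dual j) = (if i = j then 1 else 0)"
      and bil: "bilinear g"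
      and diag: "\<forall>i\<in>{1..7}. \<forall>j\<in>{1..7}. g (f_dual i) (f_dual j) =
        (if i = j then
          [71639296000000000 / 168377826559400929,
           - (1946720000000 / 2015993900449),
           - (2116000000 / 6975757441),
           21160000 / 24137569,
           - (115000 / 250563),
           - (600 / 289),
           1] ! (i - 1)
         else 0)"
    for f :: "nat \<Rightarrow> 'v \<Rightarrow> real" and f_dual :: "nat \<Rightarrow> 'v" and g :: "'v \<Rightarrow> 'v \<Rightarrow> real"
  proof -
    obtain F where F: "frame 7 f F"
      by (rule frame_of_dual_basis[OF _ f]) (simp add: assms(1), rule that)
    interpret f: frame 7 f F by (rule F)
    have "f_dual j = F j" if j: "j \<in> {1..7}" for j
    proof -
      have "f_dual j = (\<Sum>i=1..7. f i (f_dual j) *\<^sub>R F i)" by (rule f.expand)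
      also have "\<dots> = (\<Sum>i=1..7. f i (F j) *\<^sub>R F i)"
        using j f_dual by (intro sum.cong refl) (simp add: f.coord_E)
      also have "\<dots> = F j" by (rule f.expand[symmetric])
      finally show ?thesis .
    qed
    then have diag': "g (F i) (F j) =
        (if i = j then
          [71639296000000000 / 168377826559400929,
           - (1946720000000 / 2015993900449),
           - (2116000000 / 6975757441),
           21160000 / 24137569,
           - (115000 / 250563),
           - (600 / 289),
           1] ! (i - 1)
         else 0)" if "i \<in> {1..7}" "j \<in> {1..7}" for i j
      using diag that by metis
    note metric = diagonal_einstein_metric[OF F ef[rule_format] bil diag']
    have "g (F 7) (F 7) = 1" using diag'[of 7 7] by simp
    then have "\<not> ricci_flat br g"
      using metric(2) unfolding ricci_flat_def einstein_const_def
      by (metis mult_zero_left mult.right_neutral divide_eq_0_iff zero_neq_numeral)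
    then show ?thesis using metric unfolding einstein_def by blast
  qed
  show ?thesis
  proof (intro conjI allI impI)
    show "\<exists>\<phi>. closed_g2star br \<phi>" by (rule ex_closed_g2star)
    show "\<nexists>\<rho>. closed_g2star br \<rho> \<and> einstein br (g_form \<rho>) \<and> \<not> ricci_flat br (g_form \<rho>)"
      using obstruction by blast
  next
    fix f :: "nat \<Rightarrow> 'v \<Rightarrow> real" and f_dual :: "nat \<Rightarrow> 'v" and g :: "'v \<Rightarrow> 'v \<Rightarrow> real"
    assume H: "is_dual_basis 7 f \<and>
      (\<forall>x. e 1 x = f 1 x) \<and>
      (\<forall>x. e 2 x = f 2 x) \<and>
      (\<forall>x. e 3 x = - (26 / 51) * f 2 x + f 3 x) \<and>
      (\<forall>x. e 4 x = - (2300 / 2601) * f 2 x - (26 / 51) * f 3 x + f 4 x) \<and>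
      (\<forall>x. e 5 x = - (2300 / 2601) * f 3 x + (46 / 51) * f 4 x + f 5 x) \<and>
      (\<forall>x. e 6 x = - (2300 / 2601) * f 4 x + f 6 x) \<and>
      (\<forall>x. e 7 x = - (50 / 51) * f 6 x + f 7 x) \<and>
      (\<forall>i\<in>{1..7}. \<forall>j\<in>{1..7}. f i (f_dual j) = (if i = j then 1 else 0)) \<and>
      bilinear g \<and>
      (\<forall>i\<in>{1..7}. \<forall>j\<in>{1..7}. g (f_dual i) (f_dual j) =
        (if i = j then
          [71639296000000000 / 168377826559400929,
           - (1946720000000 / 2015993900449),
           - (2116000000 / 6975757441),
           21160000 / 24137569,
           - (115000 / 250563),
           - (600 / 289),
           1] ! (i - 1)
         else 0))"
    have metric: "pseudo_metric g \<and> einstein br g \<and> \<not> ricci_flat br g"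
      using H by (elim conjE) (rule diagonal)
    then show "pseudo_metric g" "einstein br g" "\<not> ricci_flat br g" by blast+
    show "\<nexists>\<rho>. closed_g2star br \<rho> \<and> g_form \<rho> = g"
      using metric obstruction by blast
  qed
qed

end
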